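(* In the cell-probe model with words of $w=\Theta(\log N)$ bits, every deterministic data structure that answers suffix array queries for all binary strings of length at most $N$ and uses at most $S(N)=\Omega(N)$ bits of space has worst-case query time $$Q(N)\ \ge\ \Omega\!\left(\frac{\log\log N}{\log\big((S(N)/N)\log\log N\big)}\right)$$ for all sufficiently large $N$. Explicitly: for all constants $a_1,a_2,a_3>0$ there exist constants $c>0$ and $N_0$ such that the following holds for every integer $N\ge N_0$. Let $w$ be an integer with $a_1\log N\le w\le a_2\log N$ and let $S\ge a_3N$. If a deterministic static cell-probe data structure with $w$-bit cells uses at most $S$ bits of space on every binary string $T\in\{0,1\}^*$ with $2\le|T|\le N$, and for every such $T$ and every $i\in\{1,\dots,|T|\}$ answers the query $i\mapsto \mathrm{SA}_T[i]$ using at most $Q$ cell probes, then $$Q\ \ge\ c\cdot\frac{\log\log N}{\log\big((S/N)\log\log N\big)} .$$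
   Context: Logarithms are base 2. For a nonempty string $T$ of length $n$ over an ordered alphabet, the suffix array $\mathrm{SA}_T[1..n]$ is the permutation of $\{1,\dots,n\}$ such that $T[\mathrm{SA}_T[1]..n]\prec T[\mathrm{SA}_T[2]..n]\prec\cdots\prec T[\mathrm{SA}_T[n]..n]$ in lexicographic order, where a proper prefix of a string is smaller than that string. A suffix array query takes $i\in\{1,\dots,n\}$ and returns $\mathrm{SA}_T[i]$. Static cell-probe model with $w$-bit words: a preprocessing function (with no restriction on its computational cost) maps the input $T$ to a memory, i.e., a sequence of cells of $w$ bits each; the space in bits is $w$ times the number of cells. A deterministic query algorithm, given the query, adaptively reads (probes) cells, each probe's address depending on the query and the contents of cells probed so far, and outputs the answer as a function of the query and the probed contents. The query time is the worst-case number of probes; all other computation is free. *)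

theory Defs
  imports Complex_Main "HOL-Combinatorics.Permutations"
begin

section \<open>Suffix arrays\<close>

text \<open>Positions are 1-based. In \<^const>\<open>ord_class.lexordp\<close> a proper prefix precedes its
  extensions, and \<^term>\<open>False < True\<close>, so \<^typ>\<open>bool list\<close> serves as the type of binary strings.\<close>

definition suffix_from :: "'a list \<Rightarrow> nat \<Rightarrow> 'a list" where
  "suffix_from T k = drop (k - 1) T"

definition is_suffix_array :: "'a::linorder list \<Rightarrow> (nat \<Rightarrow> nat) \<Rightarrow> bool" where
  "is_suffix_array T p \<longleftrightarrow>
     p permutes {1..length T} \<and>
     (\<forall>i\<in>{1..<length T}.
        ord_class.lexordp (suffix_from T (p i)) (suffix_from T (p (Suc i))))"

definition suffix_array :: "'a::linorder list \<Rightarrow> nat \<Rightarrow> nat" where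
  "suffix_array T = (THE p. is_suffix_array T p)"

lemma suffix_from_inj: "inj_on (suffix_from T) {1..length T}"
proof (rule inj_onI)
  fix i j assume ij: "i \<in> {1..length T}" "j \<in> {1..length T}"
    and "suffix_from T i = suffix_from T j"
  then have "length T - (i - 1) = length T - (j - 1)"
    by (metis length_drop suffix_from_def)
  then show "i = j" using ij by auto
qed

lemma is_suffix_array_less:
  assumes "is_suffix_array T p" "1 \<le> i" "i < j" "j \<le> length T"
  shows "ord_class.lexordp (suffix_from T (p i)) (suffix_from T (p j))"
  using assms(3,4)
proof (induction j rule: less_induct)
  case (less j)
  then obtain k where k: "j = Suc k" by (cases j) auto
  have step: "ord_class.lexordp (suffix_from T (p k)) (suffix_from T (p j))"
    using assms(1,2) less.prems k by (auto simp: is_suffix_array_def)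
  show ?case
  proof (cases "i = k")
    case True
    then show ?thesis using step by simp
  next
    case False
    then have "ord_class.lexordp (suffix_from T (p i)) (suffix_from T (p k))"
      using less k by auto
    then show ?thesis using step by (rule lexordp_trans)
  qed
qed

definition suffix_rank :: "'a::linorder list \<Rightarrow> nat \<Rightarrow> nat" where
  "suffix_rank T k =
     card {j \<in> {1..length T}. ord_class.lexordp_eq (suffix_from T j) (suffix_from T k)}"

lemma suffix_rank_less:
  assumes "i \<in> {1..length T}" "k \<in> {1..length T}"
    and "ord_class.lexordp (suffix_from T i) (suffix_from T k)"
  shows "suffix_rank T i < suffix_rank T k"
  unfolding suffix_rank_def
proof (rule psubset_card_mono)
  let ?A = "\<lambda>k. {j \<in> {1..length T}. ord_class.lexordp_eq (suffix_from T j) (suffix_from T k)}"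
  show "finite (?A k)" by simp
  have "?A i \<subseteq> ?A k"
    using assms(3) by (auto intro: lexordp_eq_trans lexordp_into_lexordp_eq)
  moreover have "k \<in> ?A k" using assms(2) by (simp add: lexordp_eq_refl)
  moreover have "k \<notin> ?A i"
    using assms(3) by (auto dest: lexordp_eq_antisym lexordp_into_lexordp_eq
        simp: lexordp_conv_lexordp_eq)
  ultimately show "?A i \<subset> ?A k" by blast
qed

lemma suffix_rank_bij: "bij_betw (suffix_rank T) {1..length T} {1..length T}"
proof -
  have inj: "inj_on (suffix_rank T) {1..length T}"
  proof (rule inj_onI, rule ccontr)
    fix i j assume ij: "i \<in> {1..length T}" "j \<in> {1..length T}"
      and eq: "suffix_rank T i = suffix_rank T j" and ne: "i \<noteq> j"
    have "suffix_from T i \<noteq> suffix_from T j"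
      using inj_onD[OF suffix_from_inj _ ij] ne by blast
    then have "ord_class.lexordp (suffix_from T i) (suffix_from T j) \<or>
      ord_class.lexordp (suffix_from T j) (suffix_from T i)"
      using lexordp_linear by blast
    then show False using suffix_rank_less ij eq by (metis less_irrefl)
  qed
  have "suffix_rank T k \<in> {1..length T}" if "k \<in> {1..length T}" for k
  proof -
    let ?A = "{j \<in> {1..length T}. ord_class.lexordp_eq (suffix_from T j) (suffix_from T k)}"
    have "k \<in> ?A" using that by (simp add: lexordp_eq_refl)
    then have "0 < card ?A" by (auto simp: card_gt_0_iff)
    moreover have "card ?A \<le> card {1..length T}" by (rule card_mono) auto
    ultimately show ?thesis by (simp add: suffix_rank_def)
  qed
  then have "suffix_rank T ` {1..length T} \<subseteq> {1..length T}" by blast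
  then show ?thesis
    using inj by (simp add: bij_betw_def endo_inj_surj)
qed

lemma is_suffix_array_rank:
  assumes "is_suffix_array T p" "i \<in> {1..length T}"
  shows "suffix_rank T (p i) = i"
proof -
  let ?n = "length T"
  have perm: "p permutes {1..?n}" using assms(1) by (simp add: is_suffix_array_def)
  let ?A = "{j \<in> {1..?n}. ord_class.lexordp_eq (suffix_from T j) (suffix_from T (p i))}"
  have "?A = p ` {1..i}"
  proof (rule set_eqI)
    fix j show "j \<in> ?A \<longleftrightarrow> j \<in> p ` {1..i}"
    proof
      assume j: "j \<in> ?A"
      then have "j \<in> p ` {1..?n}" using permutes_image[OF perm] by auto
      then obtain k where k: "j = p k" "k \<in> {1..?n}" by blast
      have "\<not> i < k"
      proof
        assume "i < k"
        then have "ord_class.lexordp (suffix_from T (p i)) (suffix_from T j)"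
          using is_suffix_array_less[OF assms(1)] k assms(2) by auto
        then show False using j by (simp add: lexordp_conv_lexordp_eq)
      qed
      then show "j \<in> p ` {1..i}" using k by auto
    next
      assume "j \<in> p ` {1..i}"
      then obtain k where k: "j = p k" "k \<in> {1..i}" by blast
      have "p k \<in> {1..?n}"
        using permutes_in_image[OF perm, of k] k(2) assms(2) by auto
      moreover have "ord_class.lexordp_eq (suffix_from T (p k)) (suffix_from T (p i))"
        using is_suffix_array_less[OF assms(1), of k i] k(2) assms(2)
        by (cases "k = i") (auto simp: lexordp_eq_refl lexordp_into_lexordp_eq)
      ultimately show "j \<in> ?A" using k(1) by simp
    qed
  qed
  moreover have "inj_on p {1..i}" using permutes_inj[OF perm] by (auto intro: inj_on_subset)
  ultimately show ?thesis by (simp add: suffix_rank_def card_image)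
qed

lemma ex1_suffix_array: "\<exists>!p. is_suffix_array T p"
proof (rule ex_ex1I)
  let ?I = "{1..length T}"
  define p where "p i = (if i \<in> ?I then inv_into ?I (suffix_rank T) i else i)" for i
  have bij: "bij_betw (inv_into ?I (suffix_rank T)) ?I ?I"
    by (rule bij_betw_inv_into[OF suffix_rank_bij])
  have "bij_betw p ?I ?I"
    by (rule bij_betw_cong[THEN iffD1, OF _ bij]) (simp add: p_def)
  then have perm: "p permutes ?I"
    by (rule bij_imp_permutes) (auto simp: p_def)
  have rank: "suffix_rank T (p i) = i" if "i \<in> ?I" for i
    using that bij_betw_inv_into_right[OF suffix_rank_bij that] by (simp add: p_def)
  have "ord_class.lexordp (suffix_from T (p i)) (suffix_from T (p (Suc i)))"
    if "i \<in> {1..<length T}" for i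
  proof (rule ccontr)
    have i: "i \<in> ?I" "Suc i \<in> ?I" using that by auto
    then have mem: "p i \<in> ?I" "p (Suc i) \<in> ?I"
      using permutes_in_image[OF perm] by blast+
    assume n: "\<not> ord_class.lexordp (suffix_from T (p i)) (suffix_from T (p (Suc i)))"
    have "p i \<noteq> p (Suc i)" using rank i by (metis n_not_Suc_n)
    then have "suffix_from T (p i) \<noteq> suffix_from T (p (Suc i))"
      using inj_onD[OF suffix_from_inj _ mem] by blast
    then have "ord_class.lexordp (suffix_from T (p (Suc i))) (suffix_from T (p i))"
      using n lexordp_linear by blast
    then have "suffix_rank T (p (Suc i)) < suffix_rank T (p i)"
      by (rule suffix_rank_less[OF mem(2,1)])
    then show False using rank i by simp
  qed
  then show "\<exists>p. is_suffix_array T p" using perm by (auto simp: is_suffix_array_def)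
next
  fix p q assume pq: "is_suffix_array T p" "is_suffix_array T q"
  then have perm: "p permutes {1..length T}" "q permutes {1..length T}"
    by (auto simp: is_suffix_array_def)
  show "p = q"
  proof
    fix i show "p i = q i"
    proof (cases "i \<in> {1..length T}")
      case True
      then have "p i \<in> {1..length T}" "q i \<in> {1..length T}"
        using perm permutes_in_image by metis+
      moreover have "suffix_rank T (p i) = suffix_rank T (q i)"
        using is_suffix_array_rank pq True by metis
      ultimately show ?thesis
        using suffix_rank_bij by (metis bij_betw_def inj_onD)
    next
      case False
      then show ?thesis using perm by (metis permutes_not_in)
    qed
  qed
qed

lemma suffix_array_is_suffix_array: "is_suffix_array T (suffix_array T)"
  unfolding suffix_array_def by (rule theI'[OF ex1_suffix_array])


section \<open>The static cell-probe model\<close>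

type_synonym cell = "bool list"
type_synonym memory = "cell list"

definition memory_of_width :: "nat \<Rightarrow> memory \<Rightarrow> bool" where
  "memory_of_width w M \<longleftrightarrow> (\<forall>c\<in>set M. length c = w)"

definition space_bits :: "nat \<Rightarrow> memory \<Rightarrow> nat" where
  "space_bits w M = w * length M"

text \<open>What a deterministic algorithm does on a fixed query is a decision tree: the address of
  each probe, and finally the answer, are arbitrary functions of the contents read so far.\<close>

datatype 'r probe_tree = Answer 'r | Probe nat "cell \<Rightarrow> 'r probe_tree"

primrec outcome :: "memory \<Rightarrow> 'r probe_tree \<Rightarrow> 'r" where
  "outcome M (Answer r) = r"
| "outcome M (Probe a f) = outcome M (f (M ! a))"

primrec probed :: "memory \<Rightarrow> 'r probe_tree \<Rightarrow> nat list" where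
  "probed M (Answer r) = []"
| "probed M (Probe a f) = a # probed M (f (M ! a))"

text \<open>Addresses start at 0, and every probe must hit an existing cell. The query algorithm
  depends on the query alone; in particular it learns the input, and even the input's
  length, only through probes. The problem is given by the inputs \<^term>\<open>X\<close>, the queries
  \<^term>\<open>Y x\<close> allowed on \<^term>\<open>x\<close> and the required answers \<^term>\<open>ans x y\<close>.\<close>

definition cell_probe_ds ::
  "nat \<Rightarrow> real \<Rightarrow> nat \<Rightarrow> 'x set \<Rightarrow> ('x \<Rightarrow> 'y set) \<Rightarrow> ('x \<Rightarrow> 'y \<Rightarrow> 'r) \<Rightarrow>
   ('x \<Rightarrow> memory) \<Rightarrow> ('y \<Rightarrow> 'r probe_tree) \<Rightarrow> bool" where
  "cell_probe_ds w S Q X Y ans prep query \<longleftrightarrow>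
     (\<forall>x\<in>X.
        memory_of_width w (prep x) \<and>
        real (space_bits w (prep x)) \<le> S \<and>
        (\<forall>y\<in>Y x.
           set (probed (prep x) (query y)) \<subseteq> {..<length (prep x)} \<and>
           length (probed (prep x) (query y)) \<le> Q \<and>
           outcome (prep x) (query y) = ans x y))"

definition suffix_array_ds ::
  "nat \<Rightarrow> nat \<Rightarrow> real \<Rightarrow> nat \<Rightarrow> (bool list \<Rightarrow> memory) \<Rightarrow> (nat \<Rightarrow> nat probe_tree) \<Rightarrow> bool" where
  "suffix_array_ds N w S Q prep query \<longleftrightarrow>
     cell_probe_ds w S Q {T. 2 \<le> length T \<and> length T \<le> N} (\<lambda>T. {1..length T})
       suffix_array prep query"

end

(* A ball routed through a butterfly network of L <= D levels has a D-bit state at each time, and its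
   states are the D-bit windows of one bit stream. The text is the concatenation of the streams of all
   2^D balls, so suffixes starting in the streams correspond to pairs (ball, time). Whatever the
   switches are, each state occurs exactly once at each time. Hence the first D bits of the i-th
   suffix in the suffix array do not depend on the input: a suffix array query names a state at some
   time, and its answer reveals the ball, that is, the route back to time 0 ("ball inheritance").

   Suppose Q probes suffice. Probes are eliminated one at a time: a small set G of published cells
   contains the first r probes of some query in each time interval of length g * m^r, for most balls.
   If the next probes of a ball in m consecutive intervals went to few distinct cells, its route could
   be described by these coincidences with less than one bit per level, which is impossible for most
   inputs by counting. Otherwise few popular cells, added to G, catch the next probe of most balls in
   the union of the m intervals. After Q rounds the published cells answer queries about half of the
   network while being far smaller than it. The rounds fit as long as m^Q is at most log N, where m is
   a power of (S/N) log log N. *)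
theory Submission
  imports Defs "HOL-Library.FuncSet" "HOL-Library.List_Lexorder" "HOL-Library.Multiset" "HOL-Real_Asymp.Real_Asymp"
begin

section \<open>State sequences of a switching network\<close>

text \<open>The obstacle is that the suffix array index belonging to a ball at a given time depends
  on the input; only the D-bit label of an index does not. So a state yields its index only up to
  \<open>B\<close> candidates, and states or cells with more candidates are set aside as rare.
  Coincidences help because, once the contents of the published cells are fixed, the exit address of
  a query is a function of its index alone: a later state gives an index, the index a cell, the cell
  an earlier index, and this an earlier state, at a cost of O(log (L B)) bits per ball and interval.
  The gain is the switches of a whole interval between the two times. As a switch serves two balls,
  an interval of length g saves g / 2 bits, so g has to exceed log (L B) by a factor of order Q. The
  published contents depend on the input too; they are treated by a union bound and must cost less
  than the saving. Balls are named by final states because then all states after t are determined by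
  switches after t, and switches can be revealed from late to early.\<close>

definition words :: "nat \<Rightarrow> bool list set" where
  "words D = {s. length s = D}"

lemma finite_words [simp]: "finite (words D)"
  using finite_lists_length_eq[of "UNIV :: bool set" D] by (simp add: words_def)

lemma card_words: "card (words D) = 2 ^ D"
  using card_lists_length_eq[of "UNIV :: bool set" D] by (simp add: words_def)

text \<open>One step of a nonsingular feedback shift register. At time \<open>t\<close> the \<open>2 ^ D\<close> states are paired
  by their last \<open>D - 1\<close> bits, and the set \<open>x\<close> tells which pairs are switched: this is one level of a
  butterfly network.\<close>

definition fstep :: "bool list set \<Rightarrow> bool list \<Rightarrow> bool list" where
  "fstep x s = tl s @ [hd s \<noteq> (tl s \<in> x)]"

definition bstep :: "bool list set \<Rightarrow> bool list \<Rightarrow> bool list" where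
  "bstep x s = (last s \<noteq> (butlast s \<in> x)) # butlast s"

lemma bstep_fstep: "s \<noteq> [] \<Longrightarrow> bstep x (fstep x s) = s"
  by (cases s) (auto simp: bstep_def fstep_def)

lemma fstep_bstep: "s \<noteq> [] \<Longrightarrow> fstep x (bstep x s) = s"
  by (cases s rule: rev_cases) (auto simp: bstep_def fstep_def)

lemma length_fstep: "s \<noteq> [] \<Longrightarrow> length (fstep x s) = length s"
  by (cases s) (auto simp: fstep_def)

lemma length_bstep: "s \<noteq> [] \<Longrightarrow> length (bstep x s) = length s"
  by (cases s) (auto simp: bstep_def)

text \<open>The state at time \<open>t\<close> of the ball whose state at the final time \<open>L\<close> is \<open>v\<close>. Balls are named by
  their final states, since a query at time \<open>t\<close> has to find out the times before \<open>t\<close>.\<close>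

function state :: "nat \<Rightarrow> (nat \<Rightarrow> bool list set) \<Rightarrow> nat \<Rightarrow> bool list \<Rightarrow> bool list" where
  "state L X t v = (if t < L then bstep (X t) (state L X (Suc t) v) else v)"
  by auto
termination by (relation "measure (\<lambda>(L, X, t, v). L - t)") auto

declare state.simps [simp del]

lemma state_top: "L \<le> t \<Longrightarrow> state L X t v = v"
  by (simp add: state.simps)

lemma state_down: "t < L \<Longrightarrow> state L X t v = bstep (X t) (state L X (Suc t) v)"
  by (subst state.simps) simp

lemma length_state:
  assumes "v \<noteq> []"
  shows "length (state L X t v) = length v"
proof (induction "L - t" arbitrary: t)
  case 0
  then show ?case by (simp add: state_top)
next
  case (Suc k)
  then have "length (state L X (Suc t) v) = length v" by simp
  moreover from this have "state L X (Suc t) v \<noteq> []" using assms by (metis length_0_conv)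
  ultimately show ?case using Suc.hyps(2) by (subst state_down) (auto simp: length_bstep)
qed

lemma state_neq_Nil: "v \<noteq> [] \<Longrightarrow> state L X t v \<noteq> []"
  using length_state[of v L X t] by (metis length_0_conv)

lemma state_in_words: "D > 0 \<Longrightarrow> v \<in> words D \<Longrightarrow> state L X t v \<in> words D"
  using length_state[of v L X t] by (cases "v = []") (auto simp: words_def)

lemma state_cong:
  assumes "\<And>i. t \<le> i \<Longrightarrow> i < L \<Longrightarrow> X i = Y i"
  shows "state L X t v = state L Y t v"
  using assms
proof (induction "L - t" arbitrary: t)
  case 0
  then show ?case by (simp add: state_top)
next
  case (Suc k)
  then have "state L X (Suc t) v = state L Y (Suc t) v" by simp
  then show ?case using Suc by (simp add: state_down)
qed

lemma state_up:
  assumes "v \<noteq> []" "t < L"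
  shows "state L X (Suc t) v = fstep (X t) (state L X t v)"
  using assms by (simp add: state_down fstep_bstep state_neq_Nil)

lemma state_up_cong:
  assumes "v \<noteq> []" "v' \<noteq> []" "t \<le> t'" "t' \<le> L" "state L X t v = state L Y t v'"
    and "\<And>i. t \<le> i \<Longrightarrow> i < t' \<Longrightarrow> X i = Y i"
  shows "state L X t' v = state L Y t' v'"
  using assms(3,4,6)
proof (induction t' rule: dec_induct)
  case base
  then show ?case using assms by simp
next
  case (step n)
  then show ?case using assms by (simp add: state_up)
qed

lemma inj_on_state: "D > 0 \<Longrightarrow> inj_on (state L X t) (words D)"
proof (rule inj_onI)
  fix v v' assume a: "D > 0" "v \<in> words D" "v' \<in> words D" "state L X t v = state L X t v'"
  then have ne: "v \<noteq> []" "v' \<noteq> []" by (auto simp: words_def)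
  show "v = v'"
  proof (cases "t \<le> L")
    case True
    then show ?thesis using state_up_cong[OF ne True _ a(4)] by (simp add: state_top)
  next
    case False
    then show ?thesis using a by (simp add: state_top)
  qed
qed

text \<open>A bit enters at the back and moves one place forward per level. So one state shows the
  first bits of the states at the next D - 1 times, and a single known state reveals a whole stretch
  of a route.\<close>

lemma state_nth:
  assumes "k \<le> t" "k < length v" "t \<le> L"
  shows "state L X (t - k) v ! k = hd (state L X t v)"
  using assms(1,2)
proof (induction k)
  case 0
  then show ?case using state_neq_Nil[of v] by (simp add: hd_conv_nth)
next
  case (Suc k)
  have e: "Suc (t - Suc k) = t - k" using Suc.prems by simp
  have l: "length (state L X (t - k) v) = length v" using Suc.prems by (subst length_state) auto
  have "state L X (t - Suc k) v = bstep (X (t - Suc k)) (state L X (t - k) v)"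
    using Suc.prems assms(3) by (subst state_down) (auto simp: e)
  then show ?case using Suc l by (simp add: bstep_def nth_butlast)
qed

text \<open>Chain rule for counting: the coordinates are revealed in the order of \<open>\<rho>\<close>.\<close>

lemma card_le_prod_chain:
  fixes E :: "('i \<Rightarrow> 'a) set" and \<rho> :: "'i \<Rightarrow> nat" and c :: "'i \<Rightarrow> real"
  assumes "finite E" "finite J" "inj_on \<rho> J"
    and "\<And>j Y. j \<in> J \<Longrightarrow> Y \<in> E \<Longrightarrow>
          real (card {X j |X. X \<in> E \<and> (\<forall>i\<in>J. \<rho> i < \<rho> j \<longrightarrow> X i = Y i)}) \<le> c j"
    and "E \<noteq> {}"
  shows "real (card ((\<lambda>X. restrict X J) ` E)) \<le> (\<Prod>j\<in>J. c j)"
  using assms(2,3,4)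
proof (induction J rule: finite_ranking_induct[where f = \<rho>])
  case empty
  have *: "(\<lambda>X. restrict X {}) ` E = {\<lambda>_. undefined}" using assms(5) by (auto simp: restrict_def)
  show ?case unfolding * by simp
next
  case (insert x S)
  show ?case
  proof (cases "x \<in> S")
    case True
    then show ?thesis using insert by (simp add: insert_absorb)
  next
    case False
    \<comment> \<open>The induction inserts elements of maximal rank, and injectivity excludes ties:
      all of \<open>S\<close> is revealed before \<open>x\<close>.\<close>
    have lt: "\<rho> y < \<rho> x" if "y \<in> S" for y
      using insert.hyps(2)[OF that] insert.prems(1) that False
      by (metis (no_types, lifting) inj_on_eq_iff insert_iff nat_less_le)
    have IH: "real (card ((\<lambda>X. restrict X S) ` E)) \<le> (\<Prod>j\<in>S. c j)"
    proof (rule insert.IH)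
      show "inj_on \<rho> S" using insert.prems(1) by auto
      fix j Y assume j: "j \<in> S" "Y \<in> E"
      have "(\<forall>i\<in>S. \<rho> i < \<rho> j \<longrightarrow> X i = Y i) \<longleftrightarrow> (\<forall>i\<in>insert x S. \<rho> i < \<rho> j \<longrightarrow> X i = Y i)" for X
        using lt[OF j(1)] by auto
      then show "real (card {X j |X. X \<in> E \<and> (\<forall>i\<in>S. \<rho> i < \<rho> j \<longrightarrow> X i = Y i)}) \<le> c j"
        using insert.prems(2)[of j Y] j by simp
    qed
    let ?R = "\<lambda>X. restrict X S"
    let ?V = "\<lambda>Z. {X x |X. X \<in> E \<and> ?R X = Z}"
    have fin: "finite (?R ` E)" using assms(1) by simp
    have finV: "finite (?V Z)" for Z
      by (rule finite_subset[of _ "(\<lambda>X. X x) ` E"]) (use assms(1) in auto)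
    have "card ((\<lambda>X. restrict X (insert x S)) ` E) \<le> card (Sigma (?R ` E) ?V)"
    proof (rule card_inj_on_le)
      let ?f = "\<lambda>W. (restrict W S, W x)"
      show "inj_on ?f ((\<lambda>X. restrict X (insert x S)) ` E)"
      proof (rule inj_onI)
        fix A B assume a: "A \<in> (\<lambda>X. restrict X (insert x S)) ` E"
            "B \<in> (\<lambda>X. restrict X (insert x S)) ` E" and eq: "?f A = ?f B"
        show "A = B"
        proof
          fix i show "A i = B i"
          proof (cases "i \<in> S")
            case True
            then show ?thesis using eq by (metis prod.inject restrict_apply')
          next
            case False
            then show ?thesis using a eq by (cases "i = x") auto
          qed
        qed
      qed
      show "?f ` (\<lambda>X. restrict X (insert x S)) ` E \<subseteq> Sigma (?R ` E) ?V"
      proof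
        fix p assume "p \<in> ?f ` (\<lambda>X. restrict X (insert x S)) ` E"
        then obtain X where X: "X \<in> E" "p = ?f (restrict X (insert x S))" by blast
        have "insert x S \<inter> S = S" by blast
        then have "p = (?R X, X x)" using X(2) by simp
        then show "p \<in> Sigma (?R ` E) ?V" using X(1) by blast
      qed
      show "finite (Sigma (?R ` E) ?V)" using fin finV by blast
    qed
    also have "card (Sigma (?R ` E) ?V) = (\<Sum>Z\<in>?R ` E. card (?V Z))"
      using fin finV by (intro card_SigmaI) auto
    finally have "real (card ((\<lambda>X. restrict X (insert x S)) ` E)) \<le> real (\<Sum>Z\<in>?R ` E. card (?V Z))"
      by (simp only: of_nat_le_iff)
    also have "\<dots> = (\<Sum>Z\<in>?R ` E. real (card (?V Z)))" by (rule of_nat_sum)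
    also have "\<dots> \<le> (\<Sum>Z\<in>?R ` E. c x)"
    proof (rule sum_mono)
      fix Z assume "Z \<in> ?R ` E"
      then obtain Y where Y: "Y \<in> E" "Z = ?R Y" by auto
      have "?R X = Z \<longleftrightarrow> (\<forall>i\<in>insert x S. \<rho> i < \<rho> x \<longrightarrow> X i = Y i)" for X
      proof
        assume "?R X = Z"
        then have "X i = Y i" if "i \<in> S" for i using Y(2) that by (metis restrict_apply')
        then show "\<forall>i\<in>insert x S. \<rho> i < \<rho> x \<longrightarrow> X i = Y i" by auto
      next
        assume "\<forall>i\<in>insert x S. \<rho> i < \<rho> x \<longrightarrow> X i = Y i"
        then show "?R X = Z" unfolding Y(2) using lt by (intro restrict_ext) auto
      qed
      then show "real (card (?V Z)) \<le> c x" using insert.prems(2)[of x Y] Y by simp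
    qed
    also have "\<dots> = real (card (?R ` E)) * c x" by simp
    also have "\<dots> \<le> (\<Prod>j\<in>S. c j) * c x"
    proof (rule mult_right_mono[OF IH])
      obtain Y where "Y \<in> E" using assms(5) by blast
      then show "0 \<le> c x" using insert.prems(2)[of x Y] by (meson insertI1 of_nat_0_le_iff order_trans)
    qed
    also have "\<dots> = (\<Prod>j\<in>insert x S. c j)" using False insert.hyps(1) by (simp add: mult.commute)
    finally show ?thesis .
  qed
qed

section \<open>Counting inputs with many known routes\<close>

definition inputs :: "nat \<Rightarrow> nat \<Rightarrow> (nat \<Rightarrow> bool list set) set" where
  "inputs D L = (\<Pi>\<^sub>E t\<in>{..<L}. Pow (words (D - 1)))"

lemma finite_inputs [simp]: "finite (inputs D L)"
  unfolding inputs_def by (intro finite_PiE) auto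

lemma card_inputs: "card (inputs D L) = 2 ^ (L * 2 ^ (D - 1))"
  by (simp add: inputs_def card_PiE card_Pow card_words power_mult[symmetric] mult.commute)

lemma real_le_two_power: "a \<le> (2::nat) ^ k \<Longrightarrow> real a \<le> 2 ^ k"
  using of_nat_mono[of a "2 ^ k", where 'a = real] by simp

lemma two_powr_two_power: "(2::real) powr (2 ^ k) = 2 ^ (2 ^ k)"
  using powr_realpow[of 2 "2 ^ k"] by simp

lemma card_butlast:
  assumes "S \<subseteq> words D" "D > 0"
  shows "card S \<le> 2 * card (butlast ` S)"
proof -
  have fin: "finite S" using assms(1) finite_words finite_subset by blast
  have "S \<subseteq> (\<lambda>(b, y). y @ [b]) ` (UNIV \<times> butlast ` S)"
  proof
    fix s assume s: "s \<in> S"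
    then have "s \<noteq> []" using assms by (auto simp: words_def)
    then have "s = (\<lambda>(b, y). y @ [b]) (last s, butlast s)" by simp
    then show "s \<in> (\<lambda>(b, y). y @ [b]) ` (UNIV \<times> butlast ` S)" using s by blast
  qed
  then have "card S \<le> card ((\<lambda>(b, y). y @ [b]) ` ((UNIV :: bool set) \<times> butlast ` S))"
    using fin by (intro card_mono) auto
  also have "\<dots> \<le> card ((UNIV :: bool set) \<times> butlast ` S)"
    using fin by (intro card_image_le) auto
  also have "\<dots> = 2 * card (butlast ` S)" by (simp add: card_cartesian_product)
  finally show ?thesis .
qed

lemma card_subsets_agreeing:
  assumes "finite V" "W \<subseteq> V"
  shows "card {x. x \<subseteq> V \<and> x \<inter> W = y \<inter> W} \<le> 2 ^ (card V - card W)"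
proof -
  have "card {x. x \<subseteq> V \<and> x \<inter> W = y \<inter> W} \<le> card (Pow (V - W))"
  proof (rule card_inj_on_le[where f = "\<lambda>x. x - W"])
    show "inj_on (\<lambda>x. x - W) {x. x \<subseteq> V \<and> x \<inter> W = y \<inter> W}"
      by (rule inj_onI) blast
  qed (use assms in auto)
  then show ?thesis using assms by (simp add: card_Pow card_Diff_subset finite_subset)
qed

text \<open>A ball whose exit position from a block is known determines one switch per level it crosses,
  and a switch is shared by at most two balls.\<close>

lemma card_inputs_known_exits:
  fixes Ks :: "nat set" and lo :: "nat \<Rightarrow> nat" and U :: "nat \<Rightarrow> bool list set"
  assumes D: "D > 0" and LD: "L \<le> D" and fK: "finite Ks" and E: "E \<subseteq> inputs D L"
    and bnd: "\<And>e. e \<in> Ks \<Longrightarrow> lo e + g \<le> L"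
    and disj: "\<And>e e'. e \<in> Ks \<Longrightarrow> e' \<in> Ks \<Longrightarrow> e \<noteq> e' \<Longrightarrow> {lo e..<lo e + g} \<inter> {lo e'..<lo e' + g} = {}"
    and U: "\<And>e. e \<in> Ks \<Longrightarrow> U e \<subseteq> words D"
    and dec: "\<And>X Y e v. X \<in> E \<Longrightarrow> Y \<in> E \<Longrightarrow> e \<in> Ks \<Longrightarrow> v \<in> U e \<Longrightarrow>
        (\<And>t. t < L \<Longrightarrow> t \<notin> (\<Union>e\<in>Ks. {lo e..<lo e + g}) \<or> lo e + g \<le> t \<Longrightarrow> X t = Y t) \<Longrightarrow>
        state L X (lo e) v = state L Y (lo e) v"
  shows "real (card E) \<le> 2 powr (real L * 2 ^ (D - 1) - real g * (\<Sum>e\<in>Ks. real (card (U e))) / 2)"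
proof (cases "E = {}")
  case True
  then show ?thesis by simp
next
  case False
  define A where "A = (\<Union>e\<in>Ks. {lo e..<lo e + g})"
  \<comment> \<open>Times outside the blocks come first, then the times in blocks from late to
    early. When \<open>X t\<close> is revealed for \<open>t\<close> in a block, all later switches
    are known.\<close>
  define \<rho> where "\<rho> t = (if t \<in> A then 2 * L - t else t)" for t
  \<comment> \<open>The saving at level \<open>t\<close> in bits; the blocks are disjoint, so at
    most one summand is nonzero.\<close>
  define \<delta> where "\<delta> t = (\<Sum>e\<in>Ks. if t \<in> {lo e..<lo e + g} then real (card (U e)) / 2 else 0)" for t
  define c where "c t = 2 powr (2 ^ (D - 1) - \<delta> t)" for t
  have AL: "t < L" if "t \<in> A" for t
  proof -
    from that obtain e where "e \<in> Ks" "t < lo e + g" by (auto simp: A_def)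
    then show ?thesis using bnd[of e] by linarith
  qed
  have fE: "finite E" using E finite_subset finite_inputs by blast
  have "real (card ((\<lambda>X. restrict X {..<L}) ` E)) \<le> (\<Prod>j\<in>{..<L}. c j)"
  proof (rule card_le_prod_chain[where \<rho> = \<rho>])
    show "finite E" by (rule fE)
    show "finite {..<L}" by simp
    show "inj_on \<rho> {..<L}" 
    proof (rule inj_onI)
      fix x y assume "x \<in> {..<L}" "y \<in> {..<L}" "\<rho> x = \<rho> y"
      then show "x = y" using AL[of x] AL[of y] by (auto simp: \<rho>_def split: if_splits)
    qed
    show "E \<noteq> {}" by (rule False)
    fix t Y assume t: "t \<in> {..<L}" and Y: "Y \<in> E"
    let ?S = "{X t |X. X \<in> E \<and> (\<forall>i\<in>{..<L}. \<rho> i < \<rho> t \<longrightarrow> X i = Y i)}"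
    have sub: "X t \<subseteq> words (D - 1)" if "X \<in> E" for X
      using that E t by (auto simp: inputs_def PiE_def Pi_def)
    show "real (card ?S) \<le> c t"
    proof (cases "t \<in> A")
      case nA: False
      have "?S \<subseteq> Pow (words (D - 1))" using sub by auto
      then have "card ?S \<le> card (Pow (words (D - 1)))" by (intro card_mono) auto
      then have "card ?S \<le> 2 ^ (2 ^ (D - 1))" by (simp add: card_Pow card_words)
      then have "real (card ?S) \<le> 2 ^ (2 ^ (D - 1))" by (rule real_le_two_power)
      moreover have "\<delta> t = 0" unfolding \<delta>_def using nA by (intro sum.neutral) (auto simp: A_def)
      moreover have "(2::real) powr (2 ^ (D - 1)) = 2 ^ (2 ^ (D - 1))" by (rule two_powr_two_power)
      ultimately show ?thesis by (simp add: c_def)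
    next
      case True
      then obtain e where e: "e \<in> Ks" "t \<in> {lo e..<lo e + g}" by (auto simp: A_def)
      have "(if t \<in> {lo e'..<lo e' + g} then real (card (U e')) / 2 else 0) =
          (if e' = e then real (card (U e)) / 2 else 0)" if "e' \<in> Ks" for e'
        using disj[OF e(1) that] e(2) by (cases "e' = e") auto
      then have \<delta>: "\<delta> t = real (card (U e)) / 2"
        unfolding \<delta>_def using e(1) fK by (simp cong: sum.cong)
      \<comment> \<open>The switches of level \<open>t\<close> passed by the balls of
        \<open>U e\<close>. States at \<open>Suc t\<close> depend on later switches only, so
        \<open>W\<close> is the same for all inputs still possible, and only the switches outside
        \<open>W\<close> remain free.\<close>
      define W where "W = butlast ` state L Y (Suc t) ` U e"
      have stw: "state L Y (Suc t) ` U e \<subseteq> words D"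
        using U[OF e(1)] D state_in_words by blast
      have "card (U e) = card (state L Y (Suc t) ` U e)"
        by (rule card_image[symmetric], rule inj_on_subset[OF inj_on_state[OF D] U[OF e(1)]])
      also have "\<dots> \<le> 2 * card W" unfolding W_def by (rule card_butlast[OF stw D])
      finally have cW: "card (U e) \<le> 2 * card W" .
      have WV: "W \<subseteq> words (D - 1)" using stw by (auto simp: W_def words_def)
      have "?S \<subseteq> {x. x \<subseteq> words (D - 1) \<and> x \<inter> W = Y t \<inter> W}"
      proof
        fix x assume "x \<in> ?S"
        then obtain X where X: "x = X t" "X \<in> E" and ag: "\<And>i. i < L \<Longrightarrow> \<rho> i < \<rho> t \<Longrightarrow> X i = Y i" by auto
        have agA: "X i = Y i" if "i < L" "i \<notin> A \<or> t < i" for i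
          by (rule ag) (use that True AL[of i] AL[of t] t in \<open>auto simp: \<rho>_def\<close>)
        have "y \<in> X t \<longleftrightarrow> y \<in> Y t" if "y \<in> W" for y
        proof -
          from that obtain v where v: "v \<in> U e" "y = butlast (state L Y (Suc t) v)" by (auto simp: W_def)
          have vw: "v \<in> words D" using v U[OF e(1)] by blast
          then have lv: "length v = D" "v \<noteq> []" using D by (auto simp: words_def)
          have s1: "state L X (Suc t) v = state L Y (Suc t) v"
            by (rule state_cong, rule agA) auto
          have s2: "state L X (lo e) v = state L Y (lo e) v"
          proof (rule dec[OF X(2) Y e(1) v(1)])
            fix i assume "i < L" "i \<notin> (\<Union>e\<in>Ks. {lo e..<lo e + g}) \<or> lo e + g \<le> i"
            then show "X i = Y i" using e(2) by (intro agA) (auto simp: A_def)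
          qed
          have tk: "t - (t - lo e) = lo e" using e(2) by auto
          \<comment> \<open>Here \<open>L \<le> D\<close> enters: a block is no longer than a state,
            so the first bit of the state at \<open>t\<close> already stands in the state at
            \<open>lo e\<close>. Comparing it with the last bit at \<open>Suc t\<close> gives the
            switch.\<close>
          have kD: "t - lo e < length v" using e(2) bnd[OF e(1)] LD lv by auto
          have "hd (state L X t v) = hd (state L Y t v)"
            using state_nth[of "t - lo e" t v L X] state_nth[of "t - lo e" t v L Y] kD t s2 unfolding tk by simp
          moreover have "hd (state L X t v) = (last (state L Y (Suc t) v) \<noteq> (y \<in> X t))"
            using t v s1 by (simp add: state_down bstep_def)
          moreover have "hd (state L Y t v) = (last (state L Y (Suc t) v) \<noteq> (y \<in> Y t))"
            using t v by (simp add: state_down bstep_def)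
          ultimately show ?thesis by auto
        qed
        then show "x \<in> {x. x \<subseteq> words (D - 1) \<and> x \<inter> W = Y t \<inter> W}"
          using sub[OF X(2)] X(1) by auto
      qed
      then have "card ?S \<le> card {x. x \<subseteq> words (D - 1) \<and> x \<inter> W = Y t \<inter> W}"
        by (intro card_mono) auto
      also have "\<dots> \<le> 2 ^ (card (words (D - 1)) - card W)"
        by (rule card_subsets_agreeing[OF finite_words WV])
      finally have "real (card ?S) \<le> 2 ^ (card (words (D - 1)) - card W)" by (rule real_le_two_power)
      also have "\<dots> = 2 powr real (card (words (D - 1)) - card W)" by (simp add: powr_realpow)
      also have "real (card (words (D - 1)) - card W) = 2 ^ (D - 1) - real (card W)"
        using card_mono[OF finite_words WV] by (simp add: of_nat_diff card_words)
      also have "(2::real) powr (2 ^ (D - 1) - real (card W)) \<le> c t"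
        unfolding c_def \<delta> using cW by (intro powr_mono) auto
      finally show ?thesis .
    qed
  qed
  also have "(\<lambda>X. restrict X {..<L}) ` E = E"
  proof -
    have "restrict X {..<L} = X" if "X \<in> E" for X
      using that E by (auto simp: inputs_def intro: PiE_restrict)
    then show ?thesis by (simp cong: image_cong)
  qed
  also have "(\<Prod>j\<in>{..<L}. c j) = 2 powr (\<Sum>j<L. 2 ^ (D - 1) - \<delta> j)"
    unfolding c_def by (rule powr_sum[symmetric]) simp
  also have "(\<Sum>j<L. 2 ^ (D - 1) - \<delta> j) = real L * 2 ^ (D - 1) - (\<Sum>j<L. \<delta> j)"
    by (simp add: sum_subtractf)
  also have "(\<Sum>j<L. \<delta> j) = (\<Sum>e\<in>Ks. \<Sum>j<L. if j \<in> {lo e..<lo e + g} then real (card (U e)) / 2 else 0)"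
    unfolding \<delta>_def by (rule sum.swap)
  also have "\<dots> = (\<Sum>e\<in>Ks. real g * (real (card (U e)) / 2))"
  proof (rule sum.cong[OF refl])
    fix e assume e: "e \<in> Ks"
    have "{..<L} \<inter> {j. lo e \<le> j \<and> j < lo e + g} = {lo e..<lo e + g}" using bnd[OF e] by auto
    then show "(\<Sum>j<L. if j \<in> {lo e..<lo e + g} then real (card (U e)) / 2 else 0) = real g * (real (card (U e)) / 2)"
      by (simp add: sum.If_cases)
  qed
  also have "\<dots> = real g * (\<Sum>e\<in>Ks. real (card (U e))) / 2"
    by (simp add: sum_distrib_left sum_divide_distrib)
  finally show ?thesis .
qed

text \<open>Inputs with the same table of certificates fall under the preceding lemma, with
  \<open>U e\<close> the balls that have an entry for \<open>e\<close>; the power counts the tables.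
  A table costs log (1 + |W|) bits per block and ball, an entry saves \<open>g / 2\<close>.\<close>

lemma card_inputs_certified:
  fixes Ks :: "nat set" and lo :: "nat \<Rightarrow> nat"
    and cert :: "(nat \<Rightarrow> bool list set) \<Rightarrow> nat \<times> bool list \<Rightarrow> 'c option"
  assumes D: "D > 0" and LD: "L \<le> D" and fK: "finite Ks" and E: "E \<subseteq> inputs D L"
    and bnd: "\<And>e. e \<in> Ks \<Longrightarrow> lo e + g \<le> L"
    and disj: "\<And>e e'. e \<in> Ks \<Longrightarrow> e' \<in> Ks \<Longrightarrow> e \<noteq> e' \<Longrightarrow> {lo e..<lo e + g} \<inter> {lo e'..<lo e' + g} = {}"
    and fW: "finite W"
    and cert: "\<And>X p. X \<in> E \<Longrightarrow> p \<in> Ks \<times> words D \<Longrightarrow> cert X p \<in> insert None (Some ` W)"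
    and R: "\<And>X. X \<in> E \<Longrightarrow> R \<le> real (card {p \<in> Ks \<times> words D. cert X p \<noteq> None})"
    and dec: "\<And>X Y e v c. X \<in> E \<Longrightarrow> Y \<in> E \<Longrightarrow> e \<in> Ks \<Longrightarrow> v \<in> words D \<Longrightarrow>
        cert X (e, v) = Some c \<Longrightarrow> cert Y (e, v) = Some c \<Longrightarrow>
        (\<And>t. t < L \<Longrightarrow> t \<notin> (\<Union>e\<in>Ks. {lo e..<lo e + g}) \<or> lo e + g \<le> t \<Longrightarrow> X t = Y t) \<Longrightarrow>
        state L X (lo e) v = state L Y (lo e) v"
  shows "real (card E) \<le> (1 + real (card W)) ^ (card Ks * 2 ^ D) * 2 powr (real L * 2 ^ (D - 1) - real g * R / 2)"
proof -
  define P where "P = Ks \<times> words D"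
  define C where "C = (\<Pi>\<^sub>E p\<in>P. insert None (Some ` W))"
  define F where "F \<kappa> = {X \<in> E. restrict (cert X) P = \<kappa>}" for \<kappa>
  have fP: "finite P" using fK by (simp add: P_def)
  have fC: "finite C" unfolding C_def using fP fW by (intro finite_PiE) auto
  have fE: "finite E" using E finite_subset finite_inputs by blast
  have "E \<subseteq> (\<Union>\<kappa>\<in>C. F \<kappa>)"
    using cert by (auto simp: F_def C_def P_def PiE_iff)
  then have "card E \<le> card (\<Union>\<kappa>\<in>C. F \<kappa>)"
    using fC fE by (intro card_mono) (auto simp: F_def)
  also have "\<dots> \<le> (\<Sum>\<kappa>\<in>C. card (F \<kappa>))" by (rule card_UN_le[OF fC])
  finally have "real (card E) \<le> real (\<Sum>\<kappa>\<in>C. card (F \<kappa>))" by (simp only: of_nat_le_iff)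
  also have "\<dots> = (\<Sum>\<kappa>\<in>C. real (card (F \<kappa>)))" by (rule of_nat_sum)
  also have "\<dots> \<le> (\<Sum>\<kappa>\<in>C. 2 powr (real L * 2 ^ (D - 1) - real g * R / 2))"
  proof (rule sum_mono)
    fix \<kappa> assume "\<kappa> \<in> C"
    show "real (card (F \<kappa>)) \<le> 2 powr (real L * 2 ^ (D - 1) - real g * R / 2)"
    proof (cases "F \<kappa> = {}")
      case True
      then show ?thesis by simp
    next
      case False
      then obtain X0 where X0: "X0 \<in> F \<kappa>" by blast
      define U where "U e = {v \<in> words D. \<kappa> (e, v) \<noteq> None}" for e
      have \<kappa>: "cert X p = \<kappa> p" if "X \<in> F \<kappa>" "p \<in> P" for X p
        using that by (auto simp: F_def)
      have "real (card (F \<kappa>)) \<le> 2 powr (real L * 2 ^ (D - 1) - real g * (\<Sum>e\<in>Ks. real (card (U e))) / 2)"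
      proof (rule card_inputs_known_exits[OF D LD fK _ bnd disj])
        show "F \<kappa> \<subseteq> inputs D L" using E by (auto simp: F_def)
        show "U e \<subseteq> words D" for e by (auto simp: U_def)
        fix X Y e v assume a: "X \<in> F \<kappa>" "Y \<in> F \<kappa>" "e \<in> Ks" "v \<in> U e"
          and ag: "\<And>t. t < L \<Longrightarrow> t \<notin> (\<Union>e\<in>Ks. {lo e..<lo e + g}) \<or> lo e + g \<le> t \<Longrightarrow> X t = Y t"
        obtain c where c: "\<kappa> (e, v) = Some c" using a(4) by (auto simp: U_def)
        show "state L X (lo e) v = state L Y (lo e) v"
        proof (rule dec)
          show "X \<in> E" "Y \<in> E" "e \<in> Ks" "v \<in> words D" using a by (auto simp: F_def U_def)
          show "cert X (e, v) = Some c" "cert Y (e, v) = Some c"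
            using \<kappa>[OF a(1)] \<kappa>[OF a(2)] a(3,4) c by (auto simp: P_def U_def)
          show "\<And>t. t < L \<Longrightarrow> t \<notin> (\<Union>e\<in>Ks. {lo e..<lo e + g}) \<or> lo e + g \<le> t \<Longrightarrow> X t = Y t" by (rule ag)
        qed
      qed auto
      also have "\<dots> \<le> 2 powr (real L * 2 ^ (D - 1) - real g * R / 2)"
      proof -
        have "R \<le> real (card {p \<in> P. cert X0 p \<noteq> None})" using R X0 by (auto simp: P_def F_def)
        also have "{p \<in> P. cert X0 p \<noteq> None} = Sigma Ks U"
          using \<kappa>[OF X0] by (auto simp: P_def U_def)
        also have "card (Sigma Ks U) = (\<Sum>e\<in>Ks. card (U e))"
          using fK by (intro card_SigmaI) (auto simp: U_def)
        finally have "R \<le> (\<Sum>e\<in>Ks. real (card (U e)))" by simp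
        then have "real g * R \<le> real g * (\<Sum>e\<in>Ks. real (card (U e)))" by (intro mult_left_mono) auto
        then show ?thesis by (intro powr_mono) auto
      qed
      finally show ?thesis .
    qed
  qed
  also have "\<dots> = real (card C) * 2 powr (real L * 2 ^ (D - 1) - real g * R / 2)" by simp
  also have "card C = (1 + card W) ^ (card Ks * 2 ^ D)"
    unfolding C_def using fP fW
    by (simp add: card_PiE card_image card_insert_if P_def card_cartesian_product card_words)
  finally show ?thesis by simp
qed

section \<open>Partial memories\<close>

text \<open>\<open>None\<close> means that one of the first \<open>r\<close> probes leaves the
  domain of \<open>z\<close>. A query that has already answered counts as surviving all further
  probes.\<close>

fun run :: "(nat \<rightharpoonup> cell) \<Rightarrow> nat \<Rightarrow> 'r probe_tree \<Rightarrow> 'r probe_tree option" where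
  "run z 0 t = Some t"
| "run z (Suc r) (Answer a) = Some (Answer a)"
| "run z (Suc r) (Probe a f) = (case z a of None \<Rightarrow> None | Some c \<Rightarrow> run z r (f c))"

definition exit_address :: "(nat \<rightharpoonup> cell) \<Rightarrow> nat \<Rightarrow> 'r probe_tree \<Rightarrow> nat option" where
  "exit_address z r t = (case run z r t of Some (Probe a f) \<Rightarrow> Some a | _ \<Rightarrow> None)"

definition submemory :: "memory \<Rightarrow> nat set \<Rightarrow> (nat \<rightharpoonup> cell)" where
  "submemory M G a = (if a \<in> G \<and> a < length M then Some (M ! a) else None)"

lemma run_mono:
  assumes "z \<subseteq>\<^sub>m z'" "run z r t = Some t'"
  shows "run z' r t = Some t'"
  using assms
proof (induction z r t rule: run.induct)
  case (3 z r a f)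
  then obtain c where c: "z a = Some c" "run z r (f c) = Some t'" by (auto split: option.splits)
  then have "z' a = Some c" using 3(2) by (auto simp: map_le_def dom_def)
  then show ?case using 3(1)[OF c(1) 3(2) c(2)] by simp
qed auto

text \<open>\<open>run\<close> recurses on the first probe, whereas the elimination appends a probe
  at the end.\<close>

lemma run_Suc:
  "run z (Suc r) t = (case run z r t of None \<Rightarrow> None | Some (Answer a) \<Rightarrow> Some (Answer a)
     | Some (Probe a f) \<Rightarrow> map_option f (z a))"
proof (induction z r t rule: run.induct)
  case (1 z t)
  then show ?case by (cases t) (auto split: option.splits)
qed (auto split: option.splits)

lemma run_correct:
  assumes "run (submemory M G) r t = Some t'"
  shows "outcome M t' = outcome M t \<and> length (probed M t') = length (probed M t) - r \<and>
    set (probed M t') \<subseteq> set (probed M t)"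
  using assms
proof (induction "submemory M G" r t rule: run.induct)
  case (3 r a f)
  then have "submemory M G a = Some (M ! a)"
    by (auto simp: submemory_def split: option.splits if_splits)
  then show ?case using 3 by auto
qed auto

lemma submemory_mono: "G \<subseteq> G' \<Longrightarrow> submemory M G \<subseteq>\<^sub>m submemory M G'"
  by (auto simp: map_le_def submemory_def dom_def split: if_splits)

text \<open>The possible contents of the published cells, over which the union bound runs.\<close>

definition partial_memories :: "nat \<Rightarrow> nat \<Rightarrow> nat \<Rightarrow> (nat \<rightharpoonup> cell) set" where
  "partial_memories w M s =
     {z. finite (dom z) \<and> dom z \<subseteq> {..<M} \<and> card (dom z) \<le> s \<and> ran z \<subseteq> {c. length c = w}}"

lemma partial_memories_Suc:
  "partial_memories w M (Suc s) \<subseteq> partial_memories w M s \<union>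
     (\<lambda>(z, a, c). z(a \<mapsto> c)) ` (partial_memories w M s \<times> {..<M} \<times> words w)"
proof
  fix z assume z: "z \<in> partial_memories w M (Suc s)"
  show "z \<in> partial_memories w M s \<union>
     (\<lambda>(z, a, c). z(a \<mapsto> c)) ` (partial_memories w M s \<times> {..<M} \<times> words w)"
  proof (cases "card (dom z) \<le> s")
    case True
    then show ?thesis using z by (auto simp: partial_memories_def)
  next
    case False
    then have "dom z \<noteq> {}" by (metis card.empty zero_le)
    then obtain a where a: "a \<in> dom z" by blast
    then obtain c where c: "z a = Some c" by auto
    let ?y = "z(a := None)"
    have "?y \<in> partial_memories w M s"
      using z a by (auto simp: partial_memories_def ran_def)
    moreover have "a < M" "c \<in> words w"
      using z a c by (auto simp: partial_memories_def words_def ran_def)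
    moreover have "z = ?y(a \<mapsto> c)" using c by auto
    ultimately show ?thesis by (intro UnI2 image_eqI[of _ _ "(?y, a, c)"]) auto
  qed
qed

lemma card_partial_memories:
  "finite (partial_memories w M s) \<and> card (partial_memories w M s) \<le> (1 + M * 2 ^ w) ^ s"
proof (induction s)
  case 0
  have "partial_memories w M 0 \<subseteq> {Map.empty}" by (auto simp: partial_memories_def)
  then show ?case using card_mono[of "{Map.empty}" "partial_memories w M 0"] finite_subset by auto
next
  case (Suc s)
  let ?P = "partial_memories w M s"
  let ?N = "(\<lambda>(z, a, c). z(a \<mapsto> c)) ` (?P \<times> {..<M} \<times> words w)"
  have fin: "finite (?P \<union> ?N)" using Suc by simp
  have "card (partial_memories w M (Suc s)) \<le> card (?P \<union> ?N)"
    by (rule card_mono[OF fin partial_memories_Suc])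
  also have "\<dots> \<le> card ?P + card ?N" by (rule card_Un_le)
  also have "card ?N \<le> card (?P \<times> {..<M} \<times> words w)" using Suc by (intro card_image_le) auto
  also have "\<dots> = card ?P * (M * 2 ^ w)" by (simp add: card_cartesian_product card_words)
  also have "card ?P + card ?P * (M * 2 ^ w) \<le> (1 + M * 2 ^ w) ^ Suc s"
    using Suc mult_right_mono[of "card ?P" "(1 + M * 2 ^ w) ^ s" "1 + M * 2 ^ w"]
    by (simp add: algebra_simps)
  finally show ?case using fin finite_subset[OF partial_memories_Suc] by simp
qed

text \<open>As long as some cell serves at least \<open>\<theta>\<close> elements, choose it and
  delete these elements. Every choice uses up \<open>\<theta>\<close> elements of \<open>P\<close>,
  which bounds the number of choices.\<close>

lemma greedy_cover:
  fixes adr :: "'p \<Rightarrow> 'c set" and \<theta> :: real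
  assumes "finite P" "\<theta> > 0"
  shows "\<exists>G. finite G \<and> G \<subseteq> (\<Union>p\<in>P. adr p) \<and> \<theta> * card G \<le> card P \<and>
     (\<forall>c. card {p \<in> P. adr p \<inter> G = {} \<and> c \<in> adr p} < \<theta>)"
  using assms(1)
proof (induction "card P" arbitrary: P rule: less_induct)
  case less
  show ?case
  proof (cases "\<exists>c. \<theta> \<le> card {p \<in> P. c \<in> adr p}")
    case False
    then show ?thesis by (intro exI[of _ "{}"]) (auto simp: not_le)
  next
    case True
    then obtain c where c: "\<theta> \<le> card {p \<in> P. c \<in> adr p}" by blast
    let ?P = "{p \<in> P. c \<notin> adr p}"
    have eq: "card P = card ?P + card {p \<in> P. c \<in> adr p}"
      using less.prems by (subst card_Un_disjoint[symmetric]) (auto intro: arg_cong[where f = card])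
    then have "card ?P < card P" using c assms(2) by linarith
    then obtain G where G: "finite G" "G \<subseteq> (\<Union>p\<in>?P. adr p)" "\<theta> * card G \<le> card ?P"
      "\<And>c. card {p \<in> ?P. adr p \<inter> G = {} \<and> c \<in> adr p} < \<theta>"
      using less.hyps[of ?P] less.prems by auto
    have "\<theta> * card (insert c G) \<le> \<theta> * (real (card G) + 1)"
      using assms(2) G(1) by (intro mult_left_mono) (auto simp: card_insert_if)
    also have "\<dots> \<le> card P" using G(3) c eq by (simp add: algebra_simps)
    finally have "\<theta> * card (insert c G) \<le> card P" .
    moreover have "{p \<in> P. adr p \<inter> insert c G = {} \<and> c' \<in> adr p} = {p \<in> ?P. adr p \<inter> G = {} \<and> c' \<in> adr p}" for c'
      by auto
    moreover have "c \<in> (\<Union>p\<in>P. adr p)"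
    proof -
      have "{p \<in> P. c \<in> adr p} \<noteq> {}" 
      proof
        assume "{p \<in> P. c \<in> adr p} = {}"
        then show False using c assms(2) by (simp only: card.empty)
      qed
      then show ?thesis by auto
    qed
    ultimately show ?thesis using G by (intro exI[of _ "insert c G"]) auto
  qed
qed

section \<open>Eliminating one probe\<close>

lemma ex_nth_sorted_list_of_set:
  assumes "finite A" "x \<in> A"
  shows "\<exists>k<card A. sorted_list_of_set A ! k = (x::nat)"
  using assms by (metis in_set_conv_nth set_sorted_list_of_set length_sorted_list_of_set)

text \<open>The query \<open>qidx X t v\<close> asks where ball \<open>v\<close>, seen at time \<open>t\<close>, started. Its index may depend on
  the input, but the state \<open>lab\<close> that it belongs to may not; the threshold \<open>B\<close> says when a state or a
  cell has too many queries to identify one of them cheaply.\<close>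

locale scheme =
  fixes D L w M Q :: nat and I :: "nat set" and tree :: "nat \<Rightarrow> nat probe_tree"
    and lab :: "nat \<Rightarrow> bool list" and mem :: "(nat \<Rightarrow> bool list set) \<Rightarrow> memory"
    and qidx :: "(nat \<Rightarrow> bool list set) \<Rightarrow> nat \<Rightarrow> bool list \<Rightarrow> nat"
    and origin :: "nat \<Rightarrow> bool list" and B :: nat
  assumes D: "D > 0" and LD: "L \<le> D" and fI: "finite I"
    and width: "X \<in> inputs D L \<Longrightarrow> memory_of_width w (mem X)"
    and cells: "X \<in> inputs D L \<Longrightarrow> length (mem X) \<le> M"
    and qidx: "X \<in> inputs D L \<Longrightarrow> t < L \<Longrightarrow> v \<in> words D \<Longrightarrow> qidx X t v \<in> I"
    and lab: "X \<in> inputs D L \<Longrightarrow> t < L \<Longrightarrow> v \<in> words D \<Longrightarrow> lab (qidx X t v) = state L X t v"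
    and legal: "X \<in> inputs D L \<Longrightarrow> t < L \<Longrightarrow> v \<in> words D \<Longrightarrow>
      set (probed (mem X) (tree (qidx X t v))) \<subseteq> {..<length (mem X)}"
    and time: "X \<in> inputs D L \<Longrightarrow> t < L \<Longrightarrow> v \<in> words D \<Longrightarrow>
      length (probed (mem X) (tree (qidx X t v))) \<le> Q"
    and origin: "X \<in> inputs D L \<Longrightarrow> t < L \<Longrightarrow> v \<in> words D \<Longrightarrow>
      origin (outcome (mem X) (tree (qidx X t v))) = state L X 0 v"
    and B: "B > 0"
begin

definition fibre :: "bool list \<Rightarrow> nat set" where
  "fibre s = {i \<in> I. lab i = s}"

definition exits_at :: "(nat \<rightharpoonup> cell) \<Rightarrow> nat \<Rightarrow> nat \<Rightarrow> nat set" where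
  "exits_at z r c = {i \<in> I. exit_address z r (tree i) = Some c}"

text \<open>One surviving query per interval suffices, since only one exit per interval is used.
  Merging intervals therefore can only help.\<close>

definition good :: "(nat \<Rightarrow> bool list set) \<Rightarrow> nat set \<Rightarrow> nat \<Rightarrow> nat set \<Rightarrow> bool list \<Rightarrow> bool" where
  "good X G r J v \<longleftrightarrow> (\<exists>t\<in>J. run (submemory (mem X) G) r (tree (qidx X t v)) \<noteq> None)"

definition bad :: "(nat \<Rightarrow> bool list set) \<Rightarrow> nat set \<Rightarrow> nat \<Rightarrow> nat \<Rightarrow> nat \<Rightarrow> (nat \<times> bool list) set" where
  "bad X G r g E = {(e, v). e < E \<and> v \<in> words D \<and> \<not> good X G r {e * g..<e * g + g} v}"

text \<open>Both queries leave the known cells \<open>z\<close> at the same address. The query at the later time is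
  identified by its state, up to few candidates, and then the query at time \<open>t\<close> is one of the few
  that leave at that address: so the state at time \<open>t\<close> has low entropy.\<close>

definition repeats :: "(nat \<Rightarrow> bool list set) \<Rightarrow> (nat \<rightharpoonup> cell) \<Rightarrow> nat \<Rightarrow> nat \<Rightarrow> nat \<Rightarrow> bool list \<Rightarrow> bool" where
  "repeats X z r g e v \<longleftrightarrow> (\<exists>t t' c. t \<in> {e * g..<e * g + g} \<and> (e + 2) * g \<le> t' \<and> t' < L \<and>
     exit_address z r (tree (qidx X t v)) = Some c \<and> exit_address z r (tree (qidx X t' v)) = Some c \<and>
     card (exits_at z r c) \<le> B \<and> card (fibre (state L X t' v)) \<le> B)"

definition reps :: "(nat \<Rightarrow> bool list set) \<Rightarrow> (nat \<rightharpoonup> cell) \<Rightarrow> nat \<Rightarrow> nat \<Rightarrow> nat \<Rightarrow> (nat \<times> bool list) set" where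
  "reps X z r g E = {(e, v). e < E \<and> v \<in> words D \<and> repeats X z r g e v}"

definition crowded :: "(nat \<Rightarrow> bool list set) \<Rightarrow> (nat \<times> bool list) set" where
  "crowded X = {(t, v). t < L \<and> v \<in> words D \<and> card (fibre (state L X t v)) > B}"

lemma finite_fibre [simp]: "finite (fibre s)" and finite_exits_at [simp]: "finite (exits_at z r c)"
  using fI by (auto simp: fibre_def exits_at_def)

lemma finite_bad [simp]: "finite (bad X G r g E)"
  by (rule finite_subset[of _ "{..<E} \<times> words D"]) (auto simp: bad_def)

lemma finite_reps [simp]: "finite (reps X z r g E)"
  by (rule finite_subset[of _ "{..<E} \<times> words D"]) (auto simp: reps_def)

lemma finite_crowded [simp]: "finite (crowded X)"
  by (rule finite_subset[of _ "{..<L} \<times> words D"]) (auto simp: crowded_def)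

text \<open>Applied to the fibres of \<open>lab\<close> and to the sets of queries that exit at a
  common cell.\<close>

lemma card_heavy:
  assumes "finite A" "\<And>a. a \<in> A \<Longrightarrow> card (F a) > B" "\<And>a. F a \<subseteq> I"
    and "\<And>a b. a \<in> A \<Longrightarrow> b \<in> A \<Longrightarrow> a \<noteq> b \<Longrightarrow> F a \<inter> F b = {}"
  shows "B * card A \<le> card I"
proof -
  have "B * card A \<le> (\<Sum>a\<in>A. card (F a))"
    using sum_bounded_below[of A B "\<lambda>a. card (F a)"] assms(2) by (simp add: mult.commute less_imp_le)
  also have "\<dots> = card (\<Union>a\<in>A. F a)"
    using assms fI by (intro card_UN_disjoint[symmetric]) (auto intro: finite_subset)
  also have "\<dots> \<le> card I" using assms fI by (intro card_mono) auto
  finally show ?thesis .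
qed

text \<open>At a fixed time distinct balls have distinct states, so a heavy state accounts for at
  most one ball per time.\<close>

lemma card_crowded: "B * card (crowded X) \<le> L * card I"
proof -
  let ?A = "{s \<in> words D. card (fibre s) > B}"
  have "crowded X = Sigma {..<L} (\<lambda>t. {v \<in> words D. card (fibre (state L X t v)) > B})"
    by (auto simp: crowded_def)
  then have "card (crowded X) = (\<Sum>t<L. card {v \<in> words D. card (fibre (state L X t v)) > B})" by simp
  also have "\<dots> \<le> (\<Sum>t<L. card ?A)"
  proof (rule sum_mono)
    fix t
    show "card {v \<in> words D. card (fibre (state L X t v)) > B} \<le> card ?A"
    proof (rule card_inj_on_le[where f = "state L X t"])
      show "inj_on (state L X t) {v \<in> words D. card (fibre (state L X t v)) > B}"
        by (rule inj_on_subset[OF inj_on_state[OF D]]) auto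
    qed (use state_in_words[OF D] in auto)
  qed
  finally have "card (crowded X) \<le> L * card ?A" by simp
  moreover have "B * card ?A \<le> card I"
    by (rule card_heavy[where F = fibre]) (auto simp: fibre_def)
  ultimately have "B * card (crowded X) \<le> L * (B * card ?A)"
    by (metis mult.left_commute mult_le_mono2)
  also have "\<dots> \<le> L * card I" by (rule mult_le_mono2) fact
  finally show ?thesis .
qed

lemma exit_address_less:
  assumes "X \<in> inputs D L" "t < L" "v \<in> words D"
    and "exit_address (submemory (mem X) G) r (tree (qidx X t v)) = Some c"
  shows "c < length (mem X)"
proof -
  obtain f where "run (submemory (mem X) G) r (tree (qidx X t v)) = Some (Probe c f)"
    using assms(4) by (auto simp: exit_address_def split: option.splits probe_tree.splits)
  then have "c \<in> set (probed (mem X) (tree (qidx X t v)))" using run_correct by fastforce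
  then show ?thesis using legal[OF assms(1-3)] by auto
qed

lemma run_Suc_extend:
  assumes "X \<in> inputs D L" "t < L" "v \<in> words D" "G \<subseteq> G'"
    and "run (submemory (mem X) G) r (tree (qidx X t v)) \<noteq> None"
    and "\<And>c. exit_address (submemory (mem X) G) r (tree (qidx X t v)) = Some c \<Longrightarrow> c \<in> G'"
  shows "run (submemory (mem X) G') (Suc r) (tree (qidx X t v)) \<noteq> None"
proof -
  obtain t' where t': "run (submemory (mem X) G) r (tree (qidx X t v)) = Some t'" using assms(5) by blast
  then have t'': "run (submemory (mem X) G') r (tree (qidx X t v)) = Some t'"
    using run_mono[OF submemory_mono[OF assms(4)]] by blast
  show ?thesis
  proof (cases t')
    case (Answer a)
    then show ?thesis using t'' by (simp add: run_Suc)
  next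
    case (Probe c f)
    then have "exit_address (submemory (mem X) G) r (tree (qidx X t v)) = Some c"
      using t' by (simp add: exit_address_def)
    then have "c \<in> G'" "c < length (mem X)" using assms(6) exit_address_less[OF assms(1-3)] by auto
    then show ?thesis using t'' Probe by (simp add: run_Suc submemory_def)
  qed
qed

text \<open>Merge every \<open>m\<close> consecutive intervals. After adding to \<open>G\<close> the cells at which many queries exit
  and the cells that are exits for many balls, a ball that is still bad exits at few distinct cells:
  on nearly all of its \<open>m\<close> intervals the exit repeats.\<close>

lemma probe_elimination:
  fixes \<theta> :: real
  assumes X: "X \<in> inputs D L" and fG: "finite G" "G \<subseteq> {..<M}" and g: "g > 0" and m: "m > 0"
    and L: "E * m * g = L" and \<theta>: "\<theta> > 0"
  shows "\<exists>G'. finite G' \<and> G' \<subseteq> {..<M} \<and> G \<subseteq> G' \<and>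
     card G' \<le> card G + card I / B + E * 2 ^ D / \<theta> \<and>
     m * card (bad X G' (Suc r) (m * g) E) \<le> card (bad X G r g (E * m)) + L * card I / B
        + card (reps X (submemory (mem X) G) r g (E * m)) + 2 * M * \<theta>"
proof -
  define z where "z = submemory (mem X) G"
  define P where "P = {..<E} \<times> words D"
  define adr where "adr p = {c. \<exists>e t. e div m = fst p \<and> e < E * m \<and> t \<in> {e * g..<e * g + g} \<and>
      exit_address z r (tree (qidx X t (snd p))) = Some c}" for p :: "nat \<times> bool list"
  have fP: "finite P" by (simp add: P_def)
  have tL: "t < L" if "t \<in> {e * g..<e * g + g}" "e < E * m" for t e
  proof -
    have "Suc e * g \<le> E * m * g" using that(2) by (intro mult_le_mono1) simp
    then show ?thesis using that(1) L by simp
  qed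
  have adrM: "c < M" if "c \<in> adr p" "p \<in> P" for c p
    using that exit_address_less[OF X _ , of _ "snd p" G r c] tL cells[OF X]
    by (fastforce simp: adr_def P_def z_def)
  \<comment> \<open>The popular cells. A pair that is still bad after they are published avoids
    them, and every cell is an exit for fewer than \<open>\<theta>\<close> such pairs.\<close>
  obtain Gr where Gr: "finite Gr" "Gr \<subseteq> (\<Union>p\<in>P. adr p)" "\<theta> * card Gr \<le> card P"
    "\<And>c. card {p \<in> P. adr p \<inter> Gr = {} \<and> c \<in> adr p} < \<theta>"
    using greedy_cover[OF fP \<theta>, of adr] by blast
  \<comment> \<open>Exiting at such a cell would not identify the earlier query up to
    \<open>B\<close> candidates, so these few cells are published as well.\<close>
  define H where "H = {c \<in> {..<M}. card (exits_at z r c) > B}"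
  have "B * card H \<le> card I"
    by (rule card_heavy[where F = "exits_at z r"]) (auto simp: H_def exits_at_def)
  then have cH: "real (card H) \<le> card I / B"
    using B by (simp add: le_divide_eq mult.commute flip: of_nat_mult)
  have cGr: "real (card Gr) \<le> E * 2 ^ D / \<theta>"
    using Gr(3) \<theta> by (simp add: P_def card_cartesian_product card_words le_divide_eq mult.commute)
  define G' where "G' = G \<union> H \<union> Gr"
  define U where "U = bad X G' (Suc r) (m * g) E"
  have UP: "U \<subseteq> P" by (auto simp: U_def bad_def P_def)
  have fU: "finite U" by (simp add: U_def)
  \<comment> \<open>Otherwise the query has answered or its next probe is published; it then
    survives one more probe and makes the merged interval good.\<close>
  have escape: "run z r (tree (qidx X t v)) \<noteq> None \<Longrightarrow> \<exists>c. exit_address z r (tree (qidx X t v)) = Some c \<and> c \<notin> G'"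
    if u: "(e div m, v) \<in> U" "e < E * m" "t \<in> {e * g..<e * g + g}" for e v t
  proof (rule ccontr)
    assume r: "run z r (tree (qidx X t v)) \<noteq> None"
      and "\<not> (\<exists>c. exit_address z r (tree (qidx X t v)) = Some c \<and> c \<notin> G')"
    then have "run (submemory (mem X) G') (Suc r) (tree (qidx X t v)) \<noteq> None"
      using u by (intro run_Suc_extend[OF X, of t v G]) (auto simp: z_def G'_def intro: tL simp: U_def bad_def)
    moreover have "t \<in> {e div m * (m * g)..<e div m * (m * g) + m * g}"
    proof -
      have "e * g = (e div m * m + e mod m) * g" by simp
      then have e: "e * g = e div m * (m * g) + e mod m * g" by (simp only: add_mult_distrib mult.assoc)
      have "Suc (e mod m) * g \<le> m * g" using m by (intro mult_le_mono1) (simp add: Suc_leI)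
      then show ?thesis using u(3) e by auto
    qed
    ultimately show False using u(1) by (auto simp: U_def bad_def good_def)
  qed
  have adrU: "adr p \<inter> Gr = {}" if "p \<in> U" for p
  proof (rule ccontr)
    assume "adr p \<inter> Gr \<noteq> {}"
    then obtain c e t where c: "c \<in> Gr" "e div m = fst p" "e < E * m" "t \<in> {e * g..<e * g + g}"
      "exit_address z r (tree (qidx X t (snd p))) = Some c" by (auto simp: adr_def)
    have "run z r (tree (qidx X t (snd p))) \<noteq> None" using c(5) by (auto simp: exit_address_def split: option.splits)
    then show False using escape[of e "snd p" t] that c by (auto simp: G'_def)
  qed
  \<comment> \<open>Back to short intervals: each bad merged interval contributes all of its
    \<open>m\<close> parts.\<close>
  define N where "N = {(e, v). (e div m, v) \<in> U \<and> e < E * m}"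
  have "N = (\<lambda>((a, v), b). (a * m + b, v)) ` (U \<times> {..<m})"
  proof (rule set_eqI, rule iffI)
    fix p assume "p \<in> N"
    then obtain e v where p: "p = (e, v)" "(e div m, v) \<in> U" "e < E * m" by (auto simp: N_def)
    then show "p \<in> (\<lambda>((a, v), b). (a * m + b, v)) ` (U \<times> {..<m})"
      using m by (intro image_eqI[of _ _ "((e div m, v), e mod m)"]) auto
  next
    fix p assume "p \<in> (\<lambda>((a, v), b). (a * m + b, v)) ` (U \<times> {..<m})"
    then obtain a v b where p: "p = (a * m + b, v)" "(a, v) \<in> U" "b < m" by auto
    moreover have "a * m + b < E * m"
    proof -
      have "Suc a * m \<le> E * m" using p(2) by (intro mult_le_mono1) (auto simp: U_def bad_def)
      then show ?thesis using p(3) by simp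
    qed
    ultimately show "p \<in> N" by (simp add: N_def)
  qed
  moreover have "inj_on (\<lambda>((a, v), b). (a * m + b, v)) (U \<times> {..<m})"
  proof (rule inj_onI, clarsimp)
    fix a b a' b' assume "b < m" "b' < m" "a * m + b = a' * m + b'"
    then have "(a * m + b) div m = (a' * m + b') div m" "(a * m + b) mod m = (a' * m + b') mod m" by simp_all
    then show "a = a' \<and> b = b'" using \<open>b < m\<close> \<open>b' < m\<close> by simp
  qed
  ultimately have cN: "card N = m * card U" by (simp add: card_image card_cartesian_product)
  define R where "R = reps X z r g (E * m)"
  define F where "F = (\<lambda>(t, v). (t div g, v)) ` crowded X"
  define N' where "N' = N - bad X G r g (E * m) - F - R"
  \<comment> \<open>\<open>N'\<close> are the first occurrences of an exit; two of one ball at the same cell are adjacent.\<close>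
  have "\<exists>t c. t \<in> {fst p * g..<fst p * g + g} \<and> exit_address z r (tree (qidx X t (snd p))) = Some c \<and> c \<notin> G'"
    if "p \<in> N'" for p
  proof -
    obtain e v where p: "p = (e, v)" by (cases p)
    have u: "(e div m, v) \<in> U" "e < E * m" "(e, v) \<notin> bad X G r g (E * m)" using that p by (auto simp: N'_def N_def)
    then have "v \<in> words D" using UP by (auto simp: P_def)
    then obtain t where "t \<in> {e * g..<e * g + g}" "run z r (tree (qidx X t v)) \<noteq> None"
      using u by (auto simp: bad_def good_def z_def)
    then show ?thesis using escape[OF u(1,2)] p by auto
  qed
  then obtain \<tau> \<gamma> where \<tau>\<gamma>: "\<And>p. p \<in> N' \<Longrightarrow> \<tau> p \<in> {fst p * g..<fst p * g + g} \<and>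
      exit_address z r (tree (qidx X (\<tau> p) (snd p))) = Some (\<gamma> p) \<and> \<gamma> p \<notin> G'"
  proof -
    assume *: "\<And>\<tau> \<gamma>. (\<And>p. p \<in> N' \<Longrightarrow> \<tau> p \<in> {fst p * g..<fst p * g + g} \<and>
      exit_address z r (tree (qidx X (\<tau> p) (snd p))) = Some (\<gamma> p) \<and> \<gamma> p \<notin> G') \<Longrightarrow> thesis"
    assume "\<And>p. p \<in> N' \<Longrightarrow> \<exists>t c. t \<in> {fst p * g..<fst p * g + g} \<and>
      exit_address z r (tree (qidx X t (snd p))) = Some c \<and> c \<notin> G'"
    then have "\<forall>p\<in>N'. \<exists>x. fst x \<in> {fst p * g..<fst p * g + g} \<and>
      exit_address z r (tree (qidx X (fst x) (snd p))) = Some (snd x) \<and> snd x \<notin> G'" by simp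
    from bchoice[OF this] obtain h where "\<forall>p\<in>N'. fst (h p) \<in> {fst p * g..<fst p * g + g} \<and>
      exit_address z r (tree (qidx X (fst (h p)) (snd p))) = Some (snd (h p)) \<and> snd (h p) \<notin> G'" by blast
    then show thesis using *[of "fst \<circ> h" "snd \<circ> h"] by simp
  qed
  have light: "card (fibre (state L X (\<tau> p) (snd p))) \<le> B \<and> card (exits_at z r (\<gamma> p)) \<le> B \<and> \<gamma> p < M \<and>
      \<tau> p < L \<and> snd p \<in> words D \<and> fst p < E * m" if "p \<in> N'" for p
  proof -
    obtain e v where p: "p = (e, v)" by (cases p)
    have u: "(e div m, v) \<in> U" "e < E * m" "(e, v) \<notin> F" using that p by (auto simp: N'_def N_def)
    then have v: "v \<in> words D" using UP by (auto simp: P_def)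
    have t: "\<tau> p < L" using \<tau>\<gamma>[OF that] tL u p by auto
    have "\<tau> p div g = e"
      using \<tau>\<gamma>[OF that] p by (intro div_nat_eqI) (auto simp: mult.commute)
    then have "(\<tau> p, v) \<notin> crowded X" using u(3) by (auto simp: F_def image_iff)
    then have c: "card (fibre (state L X (\<tau> p) v)) \<le> B" using t v by (auto simp: crowded_def)
    have gM: "\<gamma> p < M"
      using exit_address_less[OF X t v] \<tau>\<gamma>[OF that] cells[OF X] p by (fastforce simp: z_def)
    have "\<gamma> p \<notin> H" using \<tau>\<gamma>[OF that] by (auto simp: G'_def)
    then show ?thesis using c t v gM u p by (auto simp: H_def)
  qed
  \<comment> \<open>Distinct intervals of equal parity are at distance at least 2, as
    \<open>repeats\<close> demands, so equal images would give a repeat. Recording the parity costs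
    the factor 2.\<close>
  let ?T = "(UNIV :: bool set) \<times> (SIGMA c:{..<M}. {p \<in> P. adr p \<inter> Gr = {} \<and> c \<in> adr p})"
  have fT: "finite ?T" using fP by auto
  have "card N' \<le> card ?T"
  proof (rule card_inj_on_le)
    let ?f = "\<lambda>p. (even (fst p), \<gamma> p, fst p div m, snd p)"
    show "finite ?T" by (rule fT)
    show "?f ` N' \<subseteq> ?T"
    proof (rule image_subsetI)
      fix p assume p: "p \<in> N'"
      then have u: "(fst p div m, snd p) \<in> U" by (auto simp: N'_def N_def)
      moreover have "\<gamma> p \<in> adr (fst p div m, snd p)"
        unfolding adr_def using \<tau>\<gamma>[OF p] light[OF p] by auto
      ultimately show "?f p \<in> ?T" using light[OF p] UP adrU[OF u] by auto
    qed
    have *: False if pq: "p \<in> N'" "q \<in> N'" "snd p = snd q" "\<gamma> p = \<gamma> q" "even (fst p) = even (fst q)" "fst p < fst q" for p q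
    proof -
      have "fst p + 2 \<le> fst q" using pq(5,6) by presburger
      then have "(fst p + 2) * g \<le> fst q * g" by (rule mult_le_mono1)
      also have "\<dots> \<le> \<tau> q" using \<tau>\<gamma>[OF pq(2)] by simp
      finally have "repeats X z r g (fst p) (snd p)"
        unfolding repeats_def using \<tau>\<gamma>[OF pq(1)] \<tau>\<gamma>[OF pq(2)] light[OF pq(1)] light[OF pq(2)] pq(3,4)
        by (intro exI[of _ "\<tau> p"] exI[of _ "\<tau> q"] exI[of _ "\<gamma> p"]) auto
      then have "p \<in> R" using light[OF pq(1)] by (auto simp: R_def reps_def case_prod_beta)
      then show False using pq(1) by (simp add: N'_def)
    qed
    show "inj_on ?f N'"
    proof (rule inj_onI)
      fix p q assume pq: "p \<in> N'" "q \<in> N'" "?f p = ?f q"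
      then have eq: "snd p = snd q" "\<gamma> p = \<gamma> q" "even (fst p) = even (fst q)" by auto
      have "\<not> fst p < fst q" using *[OF pq(1,2) eq] by blast
      moreover have "\<not> fst q < fst p" using *[OF pq(2,1) eq(1)[symmetric] eq(2)[symmetric] eq(3)[symmetric]] by blast
      ultimately have "fst p = fst q" by simp
      then show "p = q" using pq(3) by (simp add: prod_eq_iff)
    qed
  qed
  also have "card ?T = 2 * (\<Sum>c<M. card {p \<in> P. adr p \<inter> Gr = {} \<and> c \<in> adr p})"
    using fP by (simp add: card_cartesian_product)
  finally have "real (card N') \<le> real (2 * (\<Sum>c<M. card {p \<in> P. adr p \<inter> Gr = {} \<and> c \<in> adr p}))"
    by (simp only: of_nat_le_iff)
  also have "\<dots> = 2 * (\<Sum>c<M. real (card {p \<in> P. adr p \<inter> Gr = {} \<and> c \<in> adr p}))" by simp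
  also have "\<dots> \<le> 2 * (\<Sum>c<M. \<theta>)"
    using Gr(4) by (intro mult_left_mono sum_mono) (auto intro: less_imp_le)
  finally have cN': "real (card N') \<le> 2 * M * \<theta>" by simp
  have "card F \<le> card (crowded X)" unfolding F_def by (rule card_image_le) simp
  then have "B * card F \<le> L * card I" using card_crowded[of X] by (meson le_trans mult_le_mono2)
  then have "real (B * card F) \<le> real (L * card I)" by (simp only: of_nat_le_iff)
  then have cF: "real (card F) \<le> L * card I / B" using B by (simp add: le_divide_eq mult.commute)
  have fF: "finite F" by (simp add: F_def)
  have fN: "finite N" by (rule finite_subset[of _ "{..<E * m} \<times> words D"]) (use UP in \<open>auto simp: N_def P_def\<close>)
  have "N \<subseteq> bad X G r g (E * m) \<union> F \<union> R \<union> N'" by (auto simp: N'_def)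
  then have "card N \<le> card (bad X G r g (E * m) \<union> F \<union> R \<union> N')"
    using fF fN by (intro card_mono) (auto simp: R_def N'_def)
  also have "\<dots> \<le> card (bad X G r g (E * m)) + card F + card R + card N'"
    by (meson card_Un_le le_trans add_le_mono1)
  finally have "real (m * card U) \<le> card (bad X G r g (E * m)) + L * card I / B + card R + 2 * M * \<theta>"
    using cF cN' cN by linarith
  moreover have "card G' \<le> card G + card I / B + E * 2 ^ D / \<theta>"
  proof -
    have "card G' \<le> card G + card H + card Gr"
      unfolding G'_def by (meson card_Un_le le_trans add_le_mono1)
    then show ?thesis using cH cGr by linarith
  qed
  moreover have "G' \<subseteq> {..<M}" using fG Gr(2) adrM by (auto simp: G'_def H_def)
  moreover have "finite G'" using fG Gr(1) by (simp add: G'_def H_def)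
  ultimately show ?thesis
    by (intro exI[of _ G']) (auto simp: U_def R_def z_def G'_def)
qed

end

section \<open>The counting argument\<close>

context scheme
begin

text \<open>\<open>z\<close> is fixed and not read off \<open>mem X\<close>, so exit addresses
  depend on query indices alone.\<close>

definition repetitive :: "(nat \<rightharpoonup> cell) \<Rightarrow> nat \<Rightarrow> nat \<Rightarrow> nat \<Rightarrow> real \<Rightarrow> (nat \<Rightarrow> bool list set) set" where
  "repetitive z r g E R = {X \<in> inputs D L. R \<le> real (card (reps X z r g E))}"

text \<open>How the state at \<open>t\<close> is decoded from that at \<open>t'\<close>:
  \<open>a\<close> selects the later query in the fibre of its state, \<open>z\<close> gives its
  exit address, and \<open>b\<close> selects the earlier query among those that exit there. There
  are at most (L B)^2 such tuples.\<close>

definition repeats_witness ::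
  "(nat \<Rightarrow> bool list set) \<Rightarrow> (nat \<rightharpoonup> cell) \<Rightarrow> nat \<Rightarrow> nat \<Rightarrow> nat \<Rightarrow> bool list \<Rightarrow> nat \<times> nat \<times> nat \<times> nat \<Rightarrow> bool" where
  "repeats_witness X z r g e v = (\<lambda>(t', a, t, b). t \<in> {e * g..<e * g + g} \<and> (e + 2) * g \<le> t' \<and> t' < L \<and>
     a < B \<and> b < B \<and> t < L \<and>
     state L X t v = lab (sorted_list_of_set (exits_at z r (the (exit_address z r
       (tree (sorted_list_of_set (fibre (state L X t' v)) ! a))))) ! b))"

lemma repeats_witness:
  assumes X: "X \<in> inputs D L" and v: "v \<in> words D" and "repeats X z r g e v"
  shows "\<exists>q. repeats_witness X z r g e v q"
proof -
  from assms(3) obtain t t' c where t: "t \<in> {e * g..<e * g + g}" "(e + 2) * g \<le> t'" "t' < L"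
    and c: "exit_address z r (tree (qidx X t v)) = Some c" "exit_address z r (tree (qidx X t' v)) = Some c"
    and b: "card (exits_at z r c) \<le> B" "card (fibre (state L X t' v)) \<le> B"
    unfolding repeats_def by blast
  have "t < L" using t by auto
  have "qidx X t' v \<in> fibre (state L X t' v)" using qidx[OF X t(3) v] lab[OF X t(3) v] by (simp add: fibre_def)
  then obtain a where a: "a < B" "sorted_list_of_set (fibre (state L X t' v)) ! a = qidx X t' v"
    using ex_nth_sorted_list_of_set[OF finite_fibre] b(2) by (meson less_le_trans)
  have "qidx X t v \<in> exits_at z r c" using qidx[OF X \<open>t < L\<close> v] c by (simp add: exits_at_def)
  then obtain k where k: "k < B" "sorted_list_of_set (exits_at z r c) ! k = qidx X t v"
    using ex_nth_sorted_list_of_set[OF finite_exits_at] b(1) by (meson less_le_trans)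
  have "repeats_witness X z r g e v (t', a, t, k)"
    using t \<open>t < L\<close> a k c lab[OF X \<open>t < L\<close> v] by (simp add: repeats_witness_def)
  then show ?thesis by blast
qed

text \<open>The intervals of one parity are given for free; the certificate then determines how the balls
  cross the preceding intervals of the other parity.\<close>

lemma card_repetitive_parity:
  assumes g: "g > 0" and L: "E * g = L"
    and Ks_def: "Ks = {e. e < E \<and> e mod 2 = b \<and> e + 2 \<le> E}"
  shows "real (card {X \<in> inputs D L. R \<le> real (card {p \<in> Ks \<times> words D. repeats X z r g (fst p) (snd p)})})
    \<le> (1 + (real L * real B)\<^sup>2) ^ (E * 2 ^ D) * 2 powr (real L * 2 ^ (D - 1) - real g * R / 2)"
proof -
  let ?E = "{X \<in> inputs D L. R \<le> real (card {p \<in> Ks \<times> words D. repeats X z r g (fst p) (snd p)})}"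
  define W where "W = {..<L} \<times> {..<B} \<times> {..<L} \<times> {..<B}"
  define cert where "cert X p = (if repeats X z r g (fst p) (snd p)
     then Some (SOME q. repeats_witness X z r g (fst p) (snd p) q) else None)" for X and p :: "nat \<times> bool list"
  have wit: "repeats_witness X z r g e v q" if "X \<in> ?E" "v \<in> words D" "cert X (e, v) = Some q" for X e v q
    using someI_ex[OF repeats_witness[of X v z r g e]] that by (auto simp: cert_def split: if_splits)
  have fK: "finite Ks" by (simp add: Ks_def)
  have bnd: "Suc e * g + g \<le> L" if "e \<in> Ks" for e
  proof -
    have "(e + 2) * g \<le> E * g" using that by (intro mult_le_mono1) (simp add: Ks_def)
    then show ?thesis using L by (simp add: algebra_simps)
  qed
  have dj: "t \<notin> {Suc e' * g..<Suc e' * g + g}" if "t \<in> {e * g..<e * g + g}" "e \<noteq> Suc e'" for t e e'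
  proof
    assume "t \<in> {Suc e' * g..<Suc e' * g + g}"
    then have "t div g = Suc e'" by (intro div_nat_eqI) (auto simp: mult.commute)
    moreover have "t div g = e" using that(1) by (intro div_nat_eqI) (auto simp: mult.commute)
    ultimately show False using that(2) by simp
  qed
  \<comment> \<open>The block belonging to \<open>e\<close> is the interval \<open>e + 1\<close>;
    the gap of two intervals in \<open>repeats\<close> is what leaves it between \<open>t\<close>
    and \<open>t'\<close>.\<close>
  have "real (card ?E) \<le> (1 + real (card W)) ^ (card Ks * 2 ^ D) * 2 powr (real L * 2 ^ (D - 1) - real g * R / 2)"
  proof (rule card_inputs_certified[OF D LD fK _ bnd, where cert = cert])
    show "?E \<subseteq> inputs D L" by auto
    show "\<And>e e'. e \<in> Ks \<Longrightarrow> e' \<in> Ks \<Longrightarrow> e \<noteq> e' \<Longrightarrow>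
        {Suc e * g..<Suc e * g + g} \<inter> {Suc e' * g..<Suc e' * g + g} = {}"
      using dj by (metis Suc_inject disjoint_iff)
    show "finite W" by (simp add: W_def)
    show "cert X p \<in> insert None (Some ` W)" if "X \<in> ?E" "p \<in> Ks \<times> words D" for X p
    proof (cases "cert X p")
      case (Some q)
      have "repeats_witness X z r g (fst p) (snd p) q"
        using wit[OF that(1), of "snd p" "fst p" q] that(2) Some by auto
      then have "q \<in> W" by (auto simp: W_def repeats_witness_def split: prod.splits)
      then show ?thesis using Some by simp
    qed simp
    show "R \<le> real (card {p \<in> Ks \<times> words D. cert X p \<noteq> None})" if "X \<in> ?E" for X
    proof -
      have "cert X p \<noteq> None \<longleftrightarrow> repeats X z r g (fst p) (snd p)" for p
        by (cases "repeats X z r g (fst p) (snd p)") (simp_all only: cert_def if_True if_False option.distinct simp_thms)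
      then show ?thesis using that by (simp only: mem_Collect_eq)
    qed
    fix X Y e v q
    assume a: "X \<in> ?E" "Y \<in> ?E" "e \<in> Ks" "v \<in> words D" "cert X (e, v) = Some q" "cert Y (e, v) = Some q"
      and ag: "\<And>t. t < L \<Longrightarrow> t \<notin> (\<Union>e\<in>Ks. {Suc e * g..<Suc e * g + g}) \<or> Suc e * g + g \<le> t \<Longrightarrow> X t = Y t"
    obtain t' k t l where q: "q = (t', k, t, l)" by (cases q)
    have wX: "repeats_witness X z r g e v q" and wY: "repeats_witness Y z r g e v q"
      using wit a by blast+
    have t: "t \<in> {e * g..<e * g + g}" "(e + 2) * g \<le> t'"
      using wX by (auto simp: repeats_witness_def q)
    have "state L X t' v = state L Y t' v"
      by (rule state_cong, rule ag) (use t in \<open>auto simp: algebra_simps\<close>)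
    \<comment> \<open>Same witness and same state at \<open>t'\<close>: both inputs decode the same
      state at \<open>t\<close>.\<close>
    then have eq: "state L X t v = state L Y t v" using wX wY by (simp add: repeats_witness_def q)
    have ne: "v \<noteq> []" using a(4) D by (auto simp: words_def)
    \<comment> \<open>From \<open>t\<close> to the start of the block only interval \<open>e\<close>
      is crossed, and no block has its parity.\<close>
    show "state L X (Suc e * g) v = state L Y (Suc e * g) v"
    proof (rule state_up_cong[OF ne ne _ _ eq])
      show "t \<le> Suc e * g" using t by simp
      show "Suc e * g \<le> L" using bnd[OF a(3)] by simp
      fix i assume i: "t \<le> i" "i < Suc e * g"
      have "i \<notin> {Suc e' * g..<Suc e' * g + g}" if "e' \<in> Ks" for e'
      proof (rule dj)
        show "i \<in> {e * g..<e * g + g}" using i t(1) by auto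
        show "e \<noteq> Suc e'"
        proof
          assume "e = Suc e'"
          moreover have "e mod 2 = e' mod 2" using that a(3) by (simp add: Ks_def)
          ultimately show False by presburger
        qed
      qed
      then show "X i = Y i" using i bnd[OF a(3)] by (intro ag) auto
    qed
  qed
  also have "card W = (L * B) ^ 2" by (simp add: W_def card_cartesian_product power2_eq_square)
  also have "(1 + real ((L * B)\<^sup>2)) ^ (card Ks * 2 ^ D) * 2 powr (real L * 2 ^ (D - 1) - real g * R / 2)
     \<le> (1 + (real L * real B)\<^sup>2) ^ (E * 2 ^ D) * 2 powr (real L * 2 ^ (D - 1) - real g * R / 2)"
  proof (rule mult_right_mono)
    have "card Ks \<le> card {..<E}" by (rule card_mono) (auto simp: Ks_def)
    then show "(1 + real ((L * B)\<^sup>2)) ^ (card Ks * 2 ^ D) \<le> (1 + (real L * real B)\<^sup>2) ^ (E * 2 ^ D)"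
      by (simp add: power_increasing)
  qed simp
  finally show ?thesis .
qed

text \<open>One of the two parities contains half of the repeats; this gives the factor 2 and turns
  the divisor 2 into 4.\<close>

lemma card_repetitive:
  assumes g: "g > 0" and L: "E * g = L"
  shows "real (card (repetitive z r g E R))
    \<le> 2 * (1 + (real L * real B)\<^sup>2) ^ (E * 2 ^ D) * 2 powr (real L * 2 ^ (D - 1) - real g * R / 4)"
proof -
  define Ks where "Ks b = {e. e < E \<and> e mod 2 = b \<and> e + 2 \<le> E}" for b :: nat
  let ?R = "\<lambda>X b. {p \<in> Ks b \<times> words D. repeats X z r g (fst p) (snd p)}"
  let ?E = "\<lambda>b. {X \<in> inputs D L. R / 2 \<le> real (card (?R X b))}"
  have "repetitive z r g E R \<subseteq> ?E 0 \<union> ?E 1"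
  proof
    fix X assume X: "X \<in> repetitive z r g E R"
    have "reps X z r g E \<subseteq> ?R X 0 \<union> ?R X 1"
    proof
      fix p assume p: "p \<in> reps X z r g E"
      then have r: "repeats X z r g (fst p) (snd p)" "fst p < E" "snd p \<in> words D" by (auto simp: reps_def)
      then obtain t' where "(fst p + 2) * g \<le> t'" "t' < L" by (auto simp: repeats_def)
      then have "(fst p + 2) * g \<le> E * g" using L by simp
      then have "fst p + 2 \<le> E" using g by (simp only: mult_le_cancel2)
      then have "fst p \<in> Ks (fst p mod 2)" using r by (simp add: Ks_def)
      moreover have "fst p mod 2 = 0 \<or> fst p mod 2 = 1" by presburger
      ultimately show "p \<in> ?R X 0 \<union> ?R X 1" using r by (cases p) auto
    qed
    moreover have "finite (?R X b)" for b
      by (rule finite_subset[of _ "{..<E} \<times> words D"]) (auto simp: Ks_def)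
    ultimately have "card (reps X z r g E) \<le> card (?R X 0 \<union> ?R X 1)" by (intro card_mono) auto
    also have "\<dots> \<le> card (?R X 0) + card (?R X 1)" by (rule card_Un_le)
    finally show "X \<in> ?E 0 \<union> ?E 1" using X by (auto simp: repetitive_def)
  qed
  then have "card (repetitive z r g E R) \<le> card (?E 0 \<union> ?E 1)"
    by (intro card_mono) (auto intro: finite_subset[OF _ finite_inputs])
  also have "\<dots> \<le> card (?E 0) + card (?E 1)" by (rule card_Un_le)
  finally have "real (card (repetitive z r g E R)) \<le> real (card (?E 0)) + real (card (?E 1))" by simp
  then show ?thesis
    using card_repetitive_parity[OF g L Ks_def[of 0], of "R / 2" z r]
      card_repetitive_parity[OF g L Ks_def[of 1], of "R / 2" z r] by simp
qed

section \<open>Inputs whose starting states are revealed by the published cells\<close>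

definition resolved :: "(nat \<Rightarrow> bool list set) \<Rightarrow> (nat \<rightharpoonup> cell) \<Rightarrow> bool list \<Rightarrow> nat \<Rightarrow> nat \<Rightarrow> bool" where
  "resolved X z v t i \<longleftrightarrow> (\<exists>a. run z Q (tree i) = Some (Answer a) \<and> origin a = state L X 0 v)"

definition all_resolved :: "(nat \<rightharpoonup> cell) \<Rightarrow> nat \<Rightarrow> real \<Rightarrow> (nat \<Rightarrow> bool list set) set" where
  "all_resolved z g R = {X \<in> inputs D L. R \<le> real (card {v \<in> words D. \<exists>t. g \<le> t \<and> t < L \<and>
     card (fibre (state L X t v)) \<le> B \<and> resolved X z v t (qidx X t v)})}"

text \<open>A single block from 0 to \<open>g\<close>. The state at a time after the block follows
  from later switches; the certificate names this time and the place of the query in the fibre, and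
  \<open>z\<close> then answers with the starting state.\<close>

lemma card_all_resolved:
  assumes "g \<le> L"
  shows "real (card (all_resolved z g R))
    \<le> (1 + real L * real B) ^ (2 ^ D) * 2 powr (real L * 2 ^ (D - 1) - real g * R / 2)"
proof -
  define known where "known X v t \<longleftrightarrow> g \<le> t \<and> t < L \<and>
     card (fibre (state L X t v)) \<le> B \<and> resolved X z v t (qidx X t v)" for X v t
  define good_idx where "good_idx X v q \<longleftrightarrow> g \<le> fst q \<and> fst q < L \<and> snd q < B \<and>
     resolved X z v (fst q) (sorted_list_of_set (fibre (state L X (fst q) v)) ! snd q)" for X v and q :: "nat \<times> nat"
  define cert where "cert X p = (if \<exists>t. known X (snd p) t then Some (SOME q. good_idx X (snd p) q) else None)"
    for X and p :: "nat \<times> bool list"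
  have ex: "\<exists>q. good_idx X v q" if X: "X \<in> inputs D L" and v: "v \<in> words D" and k: "known X v t" for X v t
  proof -
    have t: "t < L" using k by (simp add: known_def)
    have "qidx X t v \<in> fibre (state L X t v)" using qidx[OF X t v] lab[OF X t v] by (simp add: fibre_def)
    then obtain a where a: "a < card (fibre (state L X t v))" "sorted_list_of_set (fibre (state L X t v)) ! a = qidx X t v"
      using ex_nth_sorted_list_of_set[OF finite_fibre] by blast
    then have "good_idx X v (t, a)" using k by (simp add: good_idx_def known_def)
    then show ?thesis by blast
  qed
  have wit: "good_idx X v q" if X: "X \<in> inputs D L" "v \<in> words D" "cert X (e, v) = Some q" for X e v q
  proof -
    obtain t where "known X v t" using X(3) by (auto simp: cert_def split: if_splits)
    from someI_ex[OF ex[OF X(1,2) this]] show ?thesis using X(3) by (auto simp: cert_def split: if_splits)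
  qed
  have sub: "all_resolved z g R \<subseteq> inputs D L" by (auto simp: all_resolved_def)
  have "real (card (all_resolved z g R)) \<le> (1 + real (card ({..<L} \<times> {..<B}))) ^ (card {0::nat} * 2 ^ D) *
     2 powr (real L * 2 ^ (D - 1) - real g * R / 2)"
  proof (rule card_inputs_certified[OF D LD, where cert = cert and lo = "\<lambda>_. 0"])
    show "all_resolved z g R \<subseteq> inputs D L" by (rule sub)
    show "cert X p \<in> insert None (Some ` ({..<L} \<times> {..<B}))"
      if "X \<in> all_resolved z g R" "p \<in> {0} \<times> words D" for X p
    proof (cases "cert X p")
      case (Some q)
      have "good_idx X (snd p) q" using wit[of X "snd p" "fst p" q] that sub Some by auto
      then show ?thesis using Some by (cases q) (auto simp: good_idx_def)
    qed simp
    show "R \<le> real (card {p \<in> {0} \<times> words D. cert X p \<noteq> None})" if "X \<in> all_resolved z g R" for X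
    proof -
      have "{p \<in> {0::nat} \<times> words D. cert X p \<noteq> None} = Pair 0 ` {v \<in> words D. \<exists>t. known X v t}"
        by (auto simp: cert_def image_iff)
      then have "card {p \<in> {0::nat} \<times> words D. cert X p \<noteq> None} = card {v \<in> words D. \<exists>t. known X v t}"
        by (simp add: card_image inj_on_def)
      then show ?thesis using that by (simp add: all_resolved_def known_def)
    qed
    fix X Y e v q
    assume a: "X \<in> all_resolved z g R" "Y \<in> all_resolved z g R" "e \<in> {0::nat}" "v \<in> words D"
      "cert X (e, v) = Some q" "cert Y (e, v) = Some q"
      and ag: "\<And>t. t < L \<Longrightarrow> t \<notin> (\<Union>e\<in>{0::nat}. {0..<0 + g}) \<or> 0 + g \<le> t \<Longrightarrow> X t = Y t"
    have w: "good_idx X v q" "good_idx Y v q" using wit a sub by blast+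
    have "state L X (fst q) v = state L Y (fst q) v"
      by (rule state_cong, rule ag) (use w in \<open>auto simp: good_idx_def\<close>)
    then show "state L X 0 v = state L Y 0 v" using w by (auto simp: good_idx_def resolved_def)
  qed (use assms in auto)
  then show ?thesis by (simp add: card_cartesian_product)
qed

section \<open>From the elimination rounds to the union bound\<close>

lemma submemory_in_partial_memories:
  assumes X: "X \<in> inputs D L" and G: "finite G" "card G \<le> s"
  shows "submemory (mem X) G \<in> partial_memories w M s"
proof -
  have "dom (submemory (mem X) G) \<subseteq> G \<inter> {..<length (mem X)}"
    by (auto simp: submemory_def split: if_splits)
  moreover from this have "card (dom (submemory (mem X) G)) \<le> card G" using G by (intro card_mono) auto
  moreover have "ran (submemory (mem X) G) \<subseteq> {c. length c = w}"
    using width[OF X] by (auto simp: ran_def submemory_def memory_of_width_def split: if_splits)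
  ultimately show ?thesis
    using G cells[OF X] finite_subset[of "dom (submemory (mem X) G)" G]
    by (auto simp: partial_memories_def)
qed

text \<open>After \<open>r\<close> rounds at most a fraction r / (4 Q) of the pairs is bad: each
  round adds three errors of 1 / (12 Q), for crowded times, repeats and exits at unpopular cells. A
  round with too many repeats is the first event; otherwise the survivors of all rounds yield the
  second.\<close>

lemma exists_event:
  fixes q :: real
  assumes X: "X \<in> inputs D L" and Q: "Q > 0" and m: "m > 0" and g: "g > 0" and q: "q > 0"
    and L: "L = 2 * m ^ Q * g"
    and h1: "L * card I / B \<le> 2 ^ D / (6 * Q)"
    and h2: "24 * Q * M \<le> q * m"
    and h3: "Q * (q + card I / B) \<le> s"
  shows "\<exists>z\<in>partial_memories w M s.
     (\<exists>r<Q. X \<in> repetitive z r (m ^ r * g) (2 * m ^ (Q - r)) (2 ^ D * (2 * real m ^ (Q - r)) / (12 * Q))) \<or>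
     X \<in> all_resolved z (m ^ Q * g) (2 ^ D / 4)"
proof (rule ccontr)
  assume no: "\<not> ?thesis"
  let ?Er = "\<lambda>r. 2 * m ^ (Q - r)" and ?gr = "\<lambda>r. m ^ r * g"
  have step: "\<exists>G. finite G \<and> G \<subseteq> {..<M} \<and> card G \<le> r * (q + card I / B) \<and>
     card (bad X G r (?gr r) (?Er r)) \<le> r / (4 * Q) * (2 ^ D * ?Er r)" if "r \<le> Q" for r
    using that
  proof (induction r)
    case 0
    have "bad X {} 0 (?gr 0) (?Er 0) = {}" using g by (auto simp: bad_def good_def)
    then show ?case by (intro exI[of _ "{}"]) simp
  next
    case (Suc r)
    then obtain G where G: "finite G" "G \<subseteq> {..<M}" "card G \<le> r * (q + card I / B)"
      "card (bad X G r (?gr r) (?Er r)) \<le> r / (4 * Q) * (2 ^ D * ?Er r)" by auto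
    have "Q - r = Suc (Q - Suc r)" using Suc.prems by simp
    then have E: "?Er (Suc r) * m = ?Er r" by simp
    have "m ^ Q = m ^ (Q - r) * m ^ r" using Suc.prems by (simp flip: power_add)
    then have EL: "?Er (Suc r) * m * ?gr r = L" unfolding E L by simp
    \<comment> \<open>Makes the bound on the number of popular cells exactly \<open>q\<close> in
      every round.\<close>
    define \<theta> where "\<theta> = 2 ^ D * ?Er (Suc r) / q"
    have \<theta>: "\<theta> > 0" using q m by (simp add: \<theta>_def)
    have "r * (q + card I / B) \<le> Q * (q + card I / B)" using Suc.prems q by (intro mult_right_mono) auto
    then have "real (card G) \<le> s" using G(3) h3 by linarith
    then have z: "submemory (mem X) G \<in> partial_memories w M s"
      using submemory_in_partial_memories[OF X G(1)] by simp
    let ?z = "submemory (mem X) G"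
    have few: "card (reps X ?z r (?gr r) (?Er r)) \<le> 2 ^ D * ?Er r / (12 * Q)"
    proof -
      have "X \<notin> repetitive ?z r (m ^ r * g) (2 * m ^ (Q - r)) (2 ^ D * (2 * real m ^ (Q - r)) / (12 * Q))"
        using no z Suc.prems by (meson Suc_le_lessD)
      then show ?thesis using X by (simp add: repetitive_def)
    qed
    obtain G' where G': "finite G'" "G' \<subseteq> {..<M}"
      "card G' \<le> card G + card I / B + ?Er (Suc r) * 2 ^ D / \<theta>"
      "m * card (bad X G' (Suc r) (m * ?gr r) (?Er (Suc r))) \<le> card (bad X G r (?gr r) (?Er (Suc r) * m))
        + L * card I / B + card (reps X ?z r (?gr r) (?Er (Suc r) * m)) + 2 * M * \<theta>"
      using probe_elimination[OF X G(1,2) _ m EL \<theta>, of r] g m by auto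
    have "?Er (Suc r) * 2 ^ D / \<theta> = q" using q m by (simp add: \<theta>_def)
    then have "card G' \<le> r * (q + card I / B) + (q + card I / B)" using G'(3) G(3) by linarith
    then have "card G' \<le> Suc r * (q + card I / B)" by (simp only: of_nat_Suc) (simp add: distrib_right)
    moreover have "card (bad X G' (Suc r) (?gr (Suc r)) (?Er (Suc r))) \<le> Suc r / (4 * Q) * (2 ^ D * ?Er (Suc r))"
    proof -
      let ?N = "2 ^ D * real (?Er r)"
      have N: "?N = m * (2 ^ D * real (?Er (Suc r)))" by (simp flip: E)
      have "1 \<le> real m ^ (Q - r)" using m by (intro one_le_power) simp
      then have "2 ^ D * 2 \<le> ?N" by simp
      then have "2 ^ D * 2 / (12 * Q) \<le> ?N / (12 * Q)" by (rule divide_right_mono) simp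
      moreover have "2 ^ D / (6 * Q) = 2 ^ D * 2 / (12 * Q)" by simp
      ultimately have a1: "L * card I / B \<le> ?N / (12 * Q)" using h1 by linarith
      have "2 * M * \<theta> = 2 * M / q * (2 ^ D * real (?Er (Suc r)))" by (simp add: \<theta>_def)
      also have "\<dots> \<le> m / (12 * Q) * (2 ^ D * real (?Er (Suc r)))"
        using h2 q Q by (intro mult_right_mono) (auto simp: field_simps)
      also have "\<dots> = ?N / (12 * Q)" using N by simp
      finally have a2: "2 * M * \<theta> \<le> ?N / (12 * Q)" .
      have "m * card (bad X G' (Suc r) (?gr (Suc r)) (?Er (Suc r))) \<le> r / (4 * Q) * ?N + 3 * (?N / (12 * Q))"
        using G'(4) a1 a2 few G(4) unfolding E by (simp add: mult.assoc)
      also have "\<dots> = Suc r / (4 * Q) * ?N"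
      proof -
        have "r / (4 * Q) * x + 3 * (x / (12 * Q)) = Suc r / (4 * Q) * x" for x :: real
          using Q by (simp add: field_simps)
        then show ?thesis .
      qed
      also have "\<dots> = m * (Suc r / (4 * Q) * (2 ^ D * real (?Er (Suc r))))" unfolding N by simp
      finally have "real m * real (card (bad X G' (Suc r) (?gr (Suc r)) (?Er (Suc r)))) \<le>
          real m * (Suc r / (4 * Q) * (2 ^ D * real (?Er (Suc r))))" by (simp only: of_nat_mult)
      then have "real (card (bad X G' (Suc r) (?gr (Suc r)) (?Er (Suc r)))) \<le>
          Suc r / (4 * Q) * (2 ^ D * real (?Er (Suc r)))" by (rule mult_left_le_imp_le) (use m in simp)
      then show ?thesis by (simp only: of_nat_mult of_nat_power of_nat_numeral)
    qed
    ultimately show ?case using G'(1,2) by blast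
  qed
  obtain G where G: "finite G" "G \<subseteq> {..<M}" "card G \<le> Q * (q + card I / B)"
     "card (bad X G Q (?gr Q) (?Er Q)) \<le> Q / (4 * Q) * (2 ^ D * ?Er Q)" using step[of Q] by blast
  let ?z = "submemory (mem X) G"
  have z: "?z \<in> partial_memories w M s" using submemory_in_partial_memories[OF X G(1), of s] G(3) h3 by simp
  let ?K = "{v \<in> words D. \<exists>t. m ^ Q * g \<le> t \<and> t < L \<and> card (fibre (state L X t v)) \<le> B \<and> resolved X ?z v t (qidx X t v)}"
  \<comment> \<open>Two intervals are left. Only the second, of index 1, is used: its queries have
    the first half of the levels before them.\<close>
  have "words D \<subseteq> ?K \<union> snd ` bad X G Q (?gr Q) 2 \<union> snd ` crowded X"
  proof
    fix v assume v: "v \<in> words D"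
    show "v \<in> ?K \<union> snd ` bad X G Q (?gr Q) 2 \<union> snd ` crowded X"
    proof (cases "(1, v) \<in> bad X G Q (?gr Q) 2")
      case True
      then show ?thesis by force
    next
      case False
      then obtain t t' where t: "t \<in> {?gr Q..<?gr Q + ?gr Q}" "run ?z Q (tree (qidx X t v)) = Some t'"
        using v by (auto simp: bad_def good_def)
      have tL: "t < L" using t(1) L by simp
      have "probed (mem X) t' = []" using run_correct[OF t(2)] time[OF X tL v] by simp
      then obtain a where a: "t' = Answer a" by (cases t') auto
      then have "a = outcome (mem X) (tree (qidx X t v))" using run_correct[OF t(2)] by simp
      then have "resolved X ?z v t (qidx X t v)" using t(2) a origin[OF X tL v] by (auto simp: resolved_def)
      then show ?thesis using t(1) tL v
        by (cases "(t, v) \<in> crowded X") (force simp: crowded_def)+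
    qed
  qed
  moreover have fin: "finite (?K \<union> snd ` bad X G Q (?gr Q) 2 \<union> snd ` crowded X)" by simp
  ultimately have "card (words D) \<le> card (?K \<union> snd ` bad X G Q (?gr Q) 2 \<union> snd ` crowded X)"
    by (intro card_mono)
  also have "\<dots> \<le> card ?K + card (snd ` bad X G Q (?gr Q) 2) + card (snd ` crowded X)"
    by (meson card_Un_le le_trans add_le_mono1)
  also have "\<dots> \<le> card ?K + card (bad X G Q (?gr Q) 2) + card (crowded X)"
    by (intro add_mono card_image_le) auto
  finally have c: "2 ^ D \<le> card ?K + card (bad X G Q (?gr Q) 2) + card (crowded X)" by (simp add: card_words)
  have "real (2 ^ D) \<le> real (card ?K + card (bad X G Q (?gr Q) 2) + card (crowded X))"
    using c by (simp only: of_nat_le_iff)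
  then have c': "2 ^ D \<le> real (card ?K) + card (bad X G Q (?gr Q) 2) + card (crowded X)" by simp
  have "real (B * card (crowded X)) \<le> real (L * card I)" using card_crowded[of X] by (simp only: of_nat_le_iff)
  then have "card (crowded X) \<le> L * card I / B" using B by (simp add: le_divide_eq mult.commute)
  also have "\<dots> \<le> 2 ^ D / (6 * Q)" by (rule h1)
  also have "\<dots> \<le> 2 ^ D / 4" using Q by (intro divide_left_mono) auto
  \<comment> \<open>At most \<open>2 ^ D / 2\<close> balls are bad and at most
    \<open>2 ^ D / 4\<close> are crowded.\<close>
  finally have "2 ^ D / 4 \<le> real (card ?K)" using c' G(4) Q by simp
  then have "X \<in> all_resolved ?z (m ^ Q * g) (2 ^ D / 4)" using X by (simp add: all_resolved_def)
  then show False using no z by blast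
qed

text \<open>The events of the preceding lemma cover all inputs. For each partial memory there are
  \<open>Q\<close> of them counted twice for the parities, and one more, which gives 2 Q + 1;
  \<open>h4\<close> says that the costs stay below the saving.\<close>

lemma impossible:
  fixes q :: real
  assumes Q: "Q > 0" and m: "m > 0" and g: "g > 0" and q: "q > 0"
    and L: "L = 2 * m ^ Q * g"
    and h1: "L * card I / B \<le> 2 ^ D / (6 * Q)"
    and h2: "24 * Q * M \<le> q * m"
    and h3: "Q * (q + card I / B) \<le> s"
    and h4: "(1 + real M * 2 ^ w) ^ s * (2 * Q + 1) * (1 + (real L * real B)\<^sup>2) ^ (2 * m ^ Q * 2 ^ D)
       < 2 powr (L * 2 ^ D / (48 * Q))"
  shows False
proof -
  define K where "K = (1 + (real L * real B)\<^sup>2) ^ (2 * m ^ Q * 2 ^ D)"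
  define V where "V = 2 powr (real L * 2 ^ (D - 1) - L * 2 ^ D / (48 * Q))"
  let ?Z = "partial_memories w M s"
  let ?repeats = "\<lambda>z r. repetitive z r (m ^ r * g) (2 * m ^ (Q - r)) (2 ^ D * (2 * real m ^ (Q - r)) / (12 * Q))"
  let ?res = "\<lambda>z. all_resolved z (m ^ Q * g) (2 ^ D / 4)"
  have fZ: "finite ?Z" and cZ: "card ?Z \<le> (1 + M * 2 ^ w) ^ s" using card_partial_memories by auto
  have L1: "1 \<le> real L * real B"
  proof -
    have "L * B > 0" using m g B by (simp add: L)
    then have "real (L * B) \<ge> 1" by linarith
    then show ?thesis by simp
  qed
  have K0: "K \<ge> 0" and V0: "V \<ge> 0" by (simp_all add: K_def V_def)
  have b1: "real (card (?repeats z r)) \<le> 2 * K * V" if "r < Q" for z r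
  proof -
    have "m ^ Q = m ^ (Q - r) * m ^ r" using that by (simp flip: power_add)
    then have e: "2 * m ^ (Q - r) * (m ^ r * g) = L" unfolding L by simp
    have "real (card (?repeats z r)) \<le> 2 * (1 + (real L * real B)\<^sup>2) ^ (2 * m ^ (Q - r) * 2 ^ D) *
       2 powr (real L * 2 ^ (D - 1) - real (m ^ r * g) * (2 ^ D * (2 * real m ^ (Q - r)) / (12 * Q)) / 4)"
      by (rule card_repetitive[OF _ e]) (use m g in simp)
    \<comment> \<open>Length times number of intervals is always \<open>L\<close>, so every round
      saves the same number of bits.\<close>
    also have "real (m ^ r * g) * (2 ^ D * (2 * real m ^ (Q - r)) / (12 * Q)) / 4 =
       real (2 * m ^ (Q - r) * (m ^ r * g)) * 2 ^ D / (48 * Q)" by (simp only: of_nat_mult of_nat_power) simp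
    also have "\<dots> = L * 2 ^ D / (48 * Q)" unfolding e by simp
    also have "2 * (1 + (real L * real B)\<^sup>2) ^ (2 * m ^ (Q - r) * 2 ^ D) *
       2 powr (real L * 2 ^ (D - 1) - L * 2 ^ D / (48 * Q)) \<le> 2 * K * V"
    proof -
      have "m ^ (Q - r) \<le> m ^ Q" using m by (intro power_increasing) auto
      then have "(1 + (real L * real B)\<^sup>2) ^ (2 * m ^ (Q - r) * 2 ^ D) \<le> K"
        unfolding K_def by (intro power_increasing) auto
      then show ?thesis unfolding V_def[symmetric] using V0 by (simp add: mult_right_mono)
    qed
    finally show ?thesis .
  qed
  have b2: "real (card (?res z)) \<le> K * V" for z
  proof -
    have "real (card (?res z)) \<le> (1 + real L * real B) ^ (2 ^ D) *
        2 powr (real L * 2 ^ (D - 1) - real (m ^ Q * g) * (2 ^ D / 4) / 2)"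
      by (rule card_all_resolved) (simp add: L)
    also have "\<dots> \<le> K * V"
    proof (rule mult_mono)
      have "(1 + real L * real B) ^ (2 ^ D) \<le> (1 + (real L * real B)\<^sup>2) ^ (2 ^ D)"
        using self_le_power[OF L1, of 2] by (intro power_mono) auto
      also have "\<dots> \<le> K" unfolding K_def using m by (intro power_increasing) auto
      finally show "(1 + real L * real B) ^ (2 ^ D) \<le> K" .
      have "L * 2 ^ D / (48 * Q) \<le> L * 2 ^ D / 16" using Q by (intro divide_left_mono) auto
      also have "\<dots> = real (m ^ Q * g) * (2 ^ D / 4) / 2" unfolding L by simp
      finally show "2 powr (real L * 2 ^ (D - 1) - real (m ^ Q * g) * (2 ^ D / 4) / 2) \<le> V"
        unfolding V_def by (intro powr_mono) auto
    qed (use K0 in auto)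
    finally show ?thesis .
  qed
  have fin: "finite (?repeats z r)" "finite (?res z)" for z r
    by (auto simp: repetitive_def all_resolved_def)
  have "inputs D L \<subseteq> (\<Union>z\<in>?Z. (\<Union>r<Q. ?repeats z r) \<union> ?res z)"
  proof
    fix X assume "X \<in> inputs D L"
    from exists_event[OF this Q m g q L h1 h2 h3] obtain z where "z \<in> ?Z"
      "(\<exists>r<Q. X \<in> ?repeats z r) \<or> X \<in> ?res z" by blast
    then show "X \<in> (\<Union>z\<in>?Z. (\<Union>r<Q. ?repeats z r) \<union> ?res z)" by blast
  qed
  then have "card (inputs D L) \<le> card (\<Union>z\<in>?Z. (\<Union>r<Q. ?repeats z r) \<union> ?res z)"
    using fZ fin by (intro card_mono) auto
  also have "\<dots> \<le> (\<Sum>z\<in>?Z. card ((\<Union>r<Q. ?repeats z r) \<union> ?res z))" by (rule card_UN_le[OF fZ])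
  also have "\<dots> \<le> (\<Sum>z\<in>?Z. (\<Sum>r<Q. card (?repeats z r)) + card (?res z))"
  proof (rule sum_mono)
    fix z
    have "card ((\<Union>r<Q. ?repeats z r) \<union> ?res z) \<le> card (\<Union>r<Q. ?repeats z r) + card (?res z)" by (rule card_Un_le)
    also have "card (\<Union>r<Q. ?repeats z r) \<le> (\<Sum>r<Q. card (?repeats z r))" by (rule card_UN_le) simp
    finally show "card ((\<Union>r<Q. ?repeats z r) \<union> ?res z) \<le> (\<Sum>r<Q. card (?repeats z r)) + card (?res z)" by simp
  qed
  finally have "real (card (inputs D L)) \<le> real (\<Sum>z\<in>?Z. (\<Sum>r<Q. card (?repeats z r)) + card (?res z))"
    by (simp only: of_nat_le_iff)
  also have "\<dots> = (\<Sum>z\<in>?Z. (\<Sum>r<Q. real (card (?repeats z r))) + real (card (?res z)))" by simp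
  also have "\<dots> \<le> (\<Sum>z\<in>?Z. (\<Sum>r<Q. 2 * K * V) + K * V)"
  proof (rule sum_mono)
    fix z
    have "(\<Sum>r<Q. real (card (?repeats z r))) \<le> (\<Sum>r<Q. 2 * K * V)" by (rule sum_mono) (simp only: lessThan_iff b1)
    then show "(\<Sum>r<Q. real (card (?repeats z r))) + real (card (?res z)) \<le> (\<Sum>r<Q. 2 * K * V) + K * V"
      using b2[of z] by linarith
  qed
  also have "\<dots> = real (card ?Z) * ((2 * Q + 1) * K * V)" by (simp add: algebra_simps)
  also have "\<dots> \<le> (1 + real M * 2 ^ w) ^ s * ((2 * Q + 1) * K * V)"
  proof (rule mult_right_mono)
    have "real (card ?Z) \<le> real ((1 + M * 2 ^ w) ^ s)" using cZ by (simp only: of_nat_le_iff)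
    then show "real (card ?Z) \<le> (1 + real M * 2 ^ w) ^ s" by simp
  qed (use K0 V0 in auto)
  also have "\<dots> = (1 + real M * 2 ^ w) ^ s * (2 * Q + 1) * K * V" by simp
  also have "\<dots> < 2 powr (L * 2 ^ D / (48 * Q)) * V"
    using h4 unfolding K_def by (intro mult_strict_right_mono) (auto simp: V_def)
  also have "\<dots> = 2 powr (real (L * 2 ^ (D - 1)))" unfolding V_def by (simp flip: powr_add)
  also have "\<dots> = real (card (inputs D L))" by (simp add: card_inputs powr_realpow del: of_nat_mult)
  finally show False by simp
qed

end

section \<open>Encoding the network as a text\<close>

primrec forward :: "(nat \<Rightarrow> bool list set) \<Rightarrow> bool list \<Rightarrow> nat \<Rightarrow> bool list" where
  "forward X u 0 = u"
| "forward X u (Suc t) = fstep (X t) (forward X u t)"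

lemma length_forward: "u \<noteq> [] \<Longrightarrow> length (forward X u t) = length u"
proof (induction t)
  case (Suc t)
  then have "forward X u t \<noteq> []" by (metis length_0_conv)
  then show ?case using Suc by (simp add: length_fstep)
qed simp

lemma forward_neq_Nil: "u \<noteq> [] \<Longrightarrow> forward X u t \<noteq> []"
  using length_forward[of u X t] by (metis length_0_conv)

lemma state_forward:
  assumes "u \<noteq> []" "t \<le> L"
  shows "state L X t (forward X u L) = forward X u t"
  using assms(2)
proof (induction "L - t" arbitrary: t)
  case 0
  then show ?case by (simp add: state_top)
next
  case (Suc k)
  then have "state L X (Suc t) (forward X u L) = forward X u (Suc t)" by simp
  then show ?case using Suc assms(1) by (simp add: state_down bstep_fstep forward_neq_Nil)
qed

lemma forward_in_words: "D > 0 \<Longrightarrow> u \<in> words D \<Longrightarrow> forward X u t \<in> words D"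
  using length_forward[of u X t] by (cases "u = []") (auto simp: words_def)

lemma bij_betw_forward: "D > 0 \<Longrightarrow> bij_betw (\<lambda>u. forward X u t) (words D) (words D)"
proof -
  assume D: "D > 0"
  have "inj_on (\<lambda>u. forward X u t) (words D)"
  proof (rule inj_onI)
    fix u u' assume a: "u \<in> words D" "u' \<in> words D" "forward X u t = forward X u' t"
    then have "u \<noteq> []" "u' \<noteq> []" using D by (auto simp: words_def)
    then have "state t X 0 (forward X u t) = u" "state t X 0 (forward X u' t) = u'" using state_forward[of _ 0 t X] by auto
    then show "u = u'" using a(3) by argo
  qed
  moreover have "(\<lambda>u. forward X u t) ` words D \<subseteq> words D" using forward_in_words[OF D] by blast
  ultimately show ?thesis unfolding bij_betw_def using endo_inj_surj[OF finite_words] by blast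
qed

text \<open>Links the two directions: the text is built forward from starting states, the counting
  goes backward from final ones.\<close>

lemma forward_state:
  assumes "D > 0" "v \<in> words D" "t \<le> L"
  shows "forward X (state L X 0 v) t = state L X t v"
proof -
  have "v \<in> (\<lambda>u. forward X u L) ` words D" using bij_betw_forward[OF assms(1)] assms(2) by (simp add: bij_betw_def)
  then obtain u where u: "u \<in> words D" "v = forward X u L" by auto
  then have "u \<noteq> []" using assms(1) by (auto simp: words_def)
  then show ?thesis using u(2) state_forward[of u _ L X] assms(3) by simp
qed

text \<open>The whole final state is appended so that the windows at all offsets up to
  \<open>L\<close> are states.\<close>

definition stream :: "nat \<Rightarrow> (nat \<Rightarrow> bool list set) \<Rightarrow> bool list \<Rightarrow> bool list" where
  "stream L X u = map (\<lambda>t. hd (forward X u t)) [0..<L] @ forward X u L"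

text \<open>The padding keeps the windows that start in one stream from reaching into the next stream.\<close>

definition block :: "nat \<Rightarrow> nat \<Rightarrow> (nat \<Rightarrow> bool list set) \<Rightarrow> bool list \<Rightarrow> bool list" where
  "block D L X u = stream L X u @ replicate D True"

definition word_list :: "nat \<Rightarrow> bool list list" where
  "word_list D = List.n_lists D [False, True]"

definition encoding :: "nat \<Rightarrow> nat \<Rightarrow> (nat \<Rightarrow> bool list set) \<Rightarrow> bool list" where
  "encoding D L X = concat (map (block D L X) (word_list D))"

lemma word_list: "set (word_list D) = words D" "distinct (word_list D)" "length (word_list D) = 2 ^ D"
proof -
  have "UNIV = {False, True}" by auto
  then show "set (word_list D) = words D"
    by (auto simp: word_list_def set_n_lists words_def)
  show "distinct (word_list D)" by (simp add: word_list_def distinct_n_lists)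
  show "length (word_list D) = 2 ^ D" by (simp add: word_list_def length_n_lists numeral_2_eq_2)
qed

lemma take_drop_stream:
  assumes "length u = D" "D > 0" "t \<le> L"
  shows "take D (drop t (stream L X u)) = forward X u t"
  using assms(3)
proof (induction "L - t" arbitrary: t)
  case 0
  then show ?case using length_forward[of u X t] assms by (auto simp: stream_def)
next
  case (Suc k)
  let ?s = "forward X u t"
  have ne: "u \<noteq> []" using assms by auto
  have tL: "t < L" using Suc by simp
  have "drop t (stream L X u) = hd ?s # drop (Suc t) (stream L X u)"
    using tL by (subst Cons_nth_drop_Suc[symmetric]) (auto simp: stream_def nth_append)
  then have "take D (drop t (stream L X u)) = hd ?s # take (D - 1) (take D (drop (Suc t) (stream L X u)))"
    using assms(2) by (cases D) (auto simp: min_def)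
  also have "take D (drop (Suc t) (stream L X u)) = fstep (X t) ?s" using Suc by simp
  also have "take (D - 1) \<dots> = tl ?s"
    using length_forward[OF ne, of X t] assms(1) by (simp add: fstep_def)
  finally show ?case using forward_neq_Nil[OF ne] by simp
qed

lemma length_stream: "length u = D \<Longrightarrow> D > 0 \<Longrightarrow> length (stream L X u) = L + D"
  using length_forward[of u X L] by (auto simp: stream_def)

lemma length_block: "length u = D \<Longrightarrow> D > 0 \<Longrightarrow> length (block D L X u) = L + 2 * D"
  by (simp add: block_def length_stream)

lemma length_concat_const: "(\<And>x. x \<in> set xs \<Longrightarrow> length x = b) \<Longrightarrow> length (concat xs) = length xs * b"
  by (induction xs) auto

lemma drop_concat_const:
  assumes "\<And>x. x \<in> set xs \<Longrightarrow> length x = b" "k < length xs" "i < b"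
  shows "drop (k * b + i) (concat xs) = drop i (xs ! k) @ concat (drop (Suc k) xs)"
  using assms
proof (induction xs arbitrary: k)
  case (Cons x xs)
  then show ?case by (cases k) auto
qed simp

lemma length_encoding: "D > 0 \<Longrightarrow> length (encoding D L X) = 2 ^ D * (L + 2 * D)"
proof -
  assume D: "D > 0"
  have "length (concat (map (block D L X) (word_list D))) = length (map (block D L X) (word_list D)) * (L + 2 * D)"
    by (rule length_concat_const) (use D in \<open>auto simp: word_list words_def length_block\<close>)
  then show ?thesis by (simp add: encoding_def word_list)
qed

lemma drop_encoding:
  assumes "D > 0" "k < 2 ^ D" "i < L + 2 * D"
  shows "drop (k * (L + 2 * D) + i) (encoding D L X) =
    drop i (block D L X (word_list D ! k)) @ concat (map (block D L X) (drop (Suc k) (word_list D)))"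
proof -
  let ?bs = "map (block D L X) (word_list D)"
  have "drop (k * (L + 2 * D) + i) (concat ?bs) = drop i (?bs ! k) @ concat (drop (Suc k) ?bs)"
    by (rule drop_concat_const) (use assms in \<open>auto simp: word_list words_def length_block\<close>)
  then show ?thesis using assms(2) by (simp add: encoding_def word_list drop_map)
qed

text \<open>The subtraction is truncated: up to offset \<open>L\<close> the window is the state
  itself. Beyond, it is a tail of the final state filled up with padding, hence still a fixed
  function of the state at one time.\<close>

lemma window_stream:
  assumes D: "D > 0" and k: "k < 2 ^ D" and i: "i < L + D"
  shows "take D (drop (k * (L + 2 * D) + i) (encoding D L X)) =
    take D (drop (i - L) (forward X (word_list D ! k) (min i L)) @ replicate D True)"
proof -
  let ?u = "word_list D ! k"
  have u: "length ?u = D" using word_list[of D] k nth_mem[of k "word_list D"] by (auto simp: words_def)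
  then have ne: "?u \<noteq> []" using D by auto
  have len: "length (forward X ?u t) = D" for t using length_forward[OF ne] u by simp
  have "drop (k * (L + 2 * D) + i) (encoding D L X) = drop i (stream L X ?u) @ replicate D True @
      concat (map (block D L X) (drop (Suc k) (word_list D)))"
    using drop_encoding[OF D k, of i L X] i u D by (simp add: block_def length_stream)
  then have *: "take D (drop (k * (L + 2 * D) + i) (encoding D L X)) = take D (drop i (stream L X ?u) @ replicate D True)"
    by simp
  show ?thesis
  proof (cases "i \<le> L")
    case True
    have "D \<le> length (drop i (stream L X ?u))" using True length_stream[OF u D, of L X] by simp
    then show ?thesis unfolding * using take_drop_stream[OF u D True, of X] True len by simp
  next
    case False
    then have "drop i (stream L X ?u) = drop (i - L) (forward X ?u L)" by (simp add: stream_def)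
    then show ?thesis unfolding * using False by simp
  qed
qed

text \<open>After the padding the window sees fewer than \<open>D\<close> bits of the next stream.
  They belong to its starting word, which is listed in a fixed order for all inputs.\<close>

lemma window_padding:
  assumes D: "D > 0" and k: "k < 2 ^ D" and i: "L + D \<le> i" "i < L + 2 * D"
  shows "take D (drop (k * (L + 2 * D) + i) (encoding D L X)) =
    take D (drop (k * (L + 2 * D) + i) (encoding D L Y))"
proof -
  let ?us = "drop (Suc k) (word_list D)"
  have u: "length (word_list D ! k) = D"
    using word_list[of D] k nth_mem[of k "word_list D"] by (auto simp: words_def)
  have eq: "take D (drop (k * (L + 2 * D) + i) (encoding D L Z)) =
      replicate (L + 2 * D - i) True @ take (i - L - D) (concat (map (block D L Z) ?us))" for Z
    using drop_encoding[OF D k i(2), of Z] i u D by (simp add: block_def length_stream)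
  have "take (i - L - D) (concat (map (block D L Z) ?us)) = take (i - L - D) (concat (take 1 ?us))" for Z
  proof (cases ?us)
    case (Cons y ys)
    then have "y \<in> set (word_list D)" using in_set_dropD[of y "Suc k" "word_list D"] by simp
    then have y: "length y = D" by (simp add: word_list words_def)
    have "take (i - L - D) (concat (map (block D L Z) ?us)) = take (i - L - D) (stream L Z y)"
      using Cons i length_stream[OF y D, of L Z] by (simp add: block_def)
    also have "\<dots> = take (i - L - D) (take D (drop 0 (stream L Z y)))" using i by simp
    also have "\<dots> = take (i - L - D) y" by (subst take_drop_stream[OF y D]) auto
    finally show ?thesis using Cons by simp
  qed simp
  then show ?thesis unfolding eq by simp
qed

section \<open>The multiset of windows of the text\<close>

definition windows :: "nat \<Rightarrow> bool list \<Rightarrow> bool list multiset" where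
  "windows D T = image_mset (\<lambda>p. take D (drop p T)) (mset_set {..<length T})"

text \<open>Positions are grouped by their offset in a block, because invariance holds for each
  offset separately and not for each block.\<close>

lemma mset_set_blocks:
  "mset_set {..<a * b :: nat} = (\<Sum>i<b. image_mset (\<lambda>k. k * b + i) (mset_set {..<a}))"
proof -
  have inj: "inj_on (\<lambda>k. k * b + i) {..<a}" if "i < b" for i using that by (auto simp: inj_on_def)
  have "{..<a * b} = (\<Union>i\<in>{..<b}. (\<lambda>k. k * b + i) ` {..<a})"
  proof (rule set_eqI, rule iffI)
    fix p assume p: "p \<in> {..<a * b}"
    then have "p div b < a" by (simp add: less_mult_imp_div_less)
    moreover have "p mod b < b" using p by (cases b) auto
    ultimately show "p \<in> (\<Union>i\<in>{..<b}. (\<lambda>k. k * b + i) ` {..<a})"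
      by (intro UN_I[of "p mod b"] image_eqI[of _ _ "p div b"]) auto
  next
    fix p assume "p \<in> (\<Union>i\<in>{..<b}. (\<lambda>k. k * b + i) ` {..<a})"
    then obtain k i where p: "p = k * b + i" "i < b" "k < a" by auto
    have "Suc k * b \<le> a * b" using p(3) by (intro mult_le_mono1) simp
    then show "p \<in> {..<a * b}" using p by simp
  qed
  also have "mset_set \<dots> = (\<Sum>i<b. mset_set ((\<lambda>k. k * b + i) ` {..<a}))"
  proof -
    have dis: "(\<lambda>k. k * b + i) ` {..<a} \<inter> (\<lambda>k. k * b + j) ` {..<a} = {}" if "i < b" "j < b" "i \<noteq> j" for i j
    proof -
      have False if "k * b + i = l * b + j" for k l
      proof -
        have "(k * b + i) mod b = (l * b + j) mod b" using that by simp
        then show False using \<open>i < b\<close> \<open>j < b\<close> \<open>i \<noteq> j\<close> by simp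
      qed
      then show ?thesis by auto
    qed
    have "mset_set (\<Union>i\<in>A. (\<lambda>k. k * b + i) ` {..<a}) = (\<Sum>i\<in>A. mset_set ((\<lambda>k. k * b + i) ` {..<a}))"
      if "A \<subseteq> {..<b}" for A
    proof -
      have "finite A" using that finite_subset by blast
      then show ?thesis using that
      proof (induction A rule: finite_induct)
        case (insert i A)
        have "(\<lambda>k. k * b + i) ` {..<a} \<inter> (\<Union>i\<in>A. (\<lambda>k. k * b + i) ` {..<a}) = {}"
          using dis[of i] insert by fastforce
        then have "mset_set ((\<lambda>k. k * b + i) ` {..<a} \<union> (\<Union>i\<in>A. (\<lambda>k. k * b + i) ` {..<a})) =
            mset_set ((\<lambda>k. k * b + i) ` {..<a}) + mset_set (\<Union>i\<in>A. (\<lambda>k. k * b + i) ` {..<a})"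
          using insert.hyps(1) by (intro mset_set_Union) auto
        then show ?case using insert by simp
      qed simp
    qed
    then show ?thesis by blast
  qed
  also have "\<dots> = (\<Sum>i<b. image_mset (\<lambda>k. k * b + i) (mset_set {..<a}))"
    using inj by (intro sum.cong) (auto simp: image_mset_mset_set)
  finally show ?thesis .
qed

lemma image_mset_sum: "image_mset f (\<Sum>i\<in>A. F i) = (\<Sum>i\<in>A. image_mset f (F i))"
  by (induction A rule: infinite_finite_induct) auto

lemma image_mset_forward:
  assumes "D > 0"
  shows "image_mset (\<lambda>k. forward X (word_list D ! k) t) (mset_set {..<2 ^ D}) = mset_set (words D)"
proof -
  have "image_mset (\<lambda>k. word_list D ! k) (mset_set {..<2 ^ D}) = mset_set (words D)"
    using bij_betw_nth[OF word_list(2)[of D], of "{..<2 ^ D}" "words D"] word_list[of D]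
    by (simp add: bij_betw_def image_mset_mset_set)
  moreover have "image_mset (\<lambda>k. forward X (word_list D ! k) t) (mset_set {..<2 ^ D}) =
      image_mset (\<lambda>u. forward X u t) (image_mset (\<lambda>k. word_list D ! k) (mset_set {..<2 ^ D}))"
    by (simp add: multiset.map_comp comp_def)
  ultimately have "image_mset (\<lambda>k. forward X (word_list D ! k) t) (mset_set {..<2 ^ D}) =
      image_mset (\<lambda>u. forward X u t) (mset_set (words D))" by simp
  also have "\<dots> = mset_set (words D)"
    using bij_betw_forward[OF assms, of X t] by (simp add: bij_betw_def image_mset_mset_set)
  finally show ?thesis .
qed

text \<open>At every offset before the padding the states of all balls run through all words, whatever
  the switches are.\<close>

lemma windows_encoding:
  assumes D: "D > 0"
  shows "windows D (encoding D L X) = windows D (encoding D L Y)"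
proof -
  let ?b = "L + 2 * D"
  have *: "windows D (encoding D L Z) = (\<Sum>i<?b. image_mset (\<lambda>k. take D (drop (k * ?b + i) (encoding D L Z))) (mset_set {..<2 ^ D}))" for Z
    unfolding windows_def length_encoding[OF D] mset_set_blocks image_mset_sum
    by (simp add: multiset.map_comp comp_def)
  have "image_mset (\<lambda>k. take D (drop (k * ?b + i) (encoding D L X))) (mset_set {..<2 ^ D}) =
     image_mset (\<lambda>k. take D (drop (k * ?b + i) (encoding D L Y))) (mset_set {..<2 ^ D})" if i: "i < ?b" for i
  proof (cases "i < L + D")
    case True
    let ?\<psi> = "\<lambda>s. take D (drop (i - L) s @ replicate D True)"
    have "image_mset (\<lambda>k. take D (drop (k * ?b + i) (encoding D L Z))) (mset_set {..<2 ^ D}) =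
       image_mset ?\<psi> (image_mset (\<lambda>k. forward Z (word_list D ! k) (min i L)) (mset_set {..<2 ^ D}))" for Z
      unfolding multiset.map_comp comp_def
      by (intro image_mset_cong window_stream[OF D]) (use True in auto)
    then show ?thesis by (simp only: image_mset_forward[OF D])
  next
    case False
    show ?thesis by (intro image_mset_cong window_padding[OF D]) (use False i in auto)
  qed
  then show ?thesis unfolding * by (intro sum.cong) auto
qed

section \<open>Suffix array queries as queries about states\<close>

lemma take_mono_lex:
  fixes xs ys :: "'a :: linorder list"
  shows "xs \<le> ys \<Longrightarrow> take n xs \<le> take n ys"
proof (induction n arbitrary: xs ys)
  case (Suc n)
  then show ?case by (cases xs; cases ys) auto
qed simp

lemma lexordp_imp_le: "ord_class.lexordp xs ys \<Longrightarrow> xs \<le> (ys :: 'a :: linorder list)"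
  by (simp add: lexordp_conv_lexord list_le_def list_less_def)

text \<open>The windows at the suffix array positions are the sorted list of all windows.\<close>

lemma suffix_array_window:
  fixes T T' :: "bool list"
  assumes "windows D T = windows D T'" "length T = length T'" "i \<in> {1..length T}"
  shows "take D (suffix_from T (suffix_array T i)) = take D (suffix_from T' (suffix_array T' i))"
proof -
  define ws where "ws S = map (\<lambda>i. take D (suffix_from S (suffix_array S i))) [1..<Suc (length S)]" for S :: "bool list"
  have nth: "ws S ! k = take D (suffix_from S (suffix_array S (Suc k)))" if "k < length S" for S k
    using that by (simp add: ws_def del: upt_Suc)
  have sorted: "sorted (ws S)" for S
    unfolding sorted_iff_nth_mono_less
  proof (intro allI impI)
    fix i j assume ij: "i < j" "j < length (ws S)"
    then have j: "j < length S" by (simp add: ws_def del: upt_Suc)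
    have "ord_class.lexordp (suffix_from S (suffix_array S (Suc i))) (suffix_from S (suffix_array S (Suc j)))"
      using is_suffix_array_less[OF suffix_array_is_suffix_array, of "Suc i" "Suc j" S] ij(1) j by simp
    then show "ws S ! i \<le> ws S ! j"
      using nth[of i S] nth[of j S] ij(1) j by (simp add: take_mono_lex lexordp_imp_le)
  qed
  have mset: "mset (ws S) = windows D S" for S
  proof -
    have perm: "suffix_array S permutes {1..length S}"
      using suffix_array_is_suffix_array[of S] by (simp add: is_suffix_array_def)
    have "mset (ws S) = image_mset (\<lambda>k. take D (suffix_from S k)) (image_mset (suffix_array S) (mset_set {1..length S}))"
      by (simp add: ws_def multiset.map_comp comp_def atLeastLessThanSuc_atLeastAtMost del: upt_Suc)
    also have "image_mset (suffix_array S) (mset_set {1..length S}) = mset_set {1..length S}"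
      using permutes_image[OF perm] permutes_inj[OF perm]
      by (simp add: image_mset_mset_set inj_on_subset)
    also have "{1..length S} = Suc ` {..<length S}"
      by (simp add: lessThan_atLeast0 atLeastLessThanSuc_atLeastAtMost)
    also have "mset_set \<dots> = image_mset Suc (mset_set {..<length S})"
      by (simp add: image_mset_mset_set)
    finally show ?thesis by (simp add: windows_def multiset.map_comp comp_def suffix_from_def)
  qed
  have "ws T = ws T'"
    using properties_for_sort[of "ws T'" "ws T"] properties_for_sort[of "ws T" "ws T"] sorted mset assms(1)
    by metis
  then have "ws T ! (i - 1) = ws T' ! (i - 1)" by simp
  then show ?thesis using nth[of "i - 1" T] nth[of "i - 1" T'] assms(2,3) by auto
qed

lemma scheme_of_suffix_array_ds:
  assumes ds: "suffix_array_ds N w S Q prep query"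
    and D: "D > 0" and LD: "L \<le> D" and N: "2 ^ D * (L + 2 * D) \<le> N" and M: "S < real w * (real M + 1)"
    and B: "B > 0"
  shows "\<exists>lab qidx origin. scheme D L w M Q {1..2 ^ D * (L + 2 * D)} query lab (\<lambda>X. prep (encoding D L X)) qidx origin B"
proof -
  let ?b = "L + 2 * D"
  define T where "T X = encoding D L X" for X
  have lenT: "length (T X) = 2 ^ D * ?b" for X by (simp add: T_def length_encoding[OF D])
  have "2 * 2 \<le> 2 ^ D * ?b"
    using D by (intro mult_le_mono self_le_power[of "2::nat" D]) auto
  then have T: "T X \<in> {T. 2 \<le> length T \<and> length T \<le> N}" for X using N by (simp add: lenT)
  \<comment> \<open>A reference input with all switches off; by invariance of the windows every
    other input gives the same labels.\<close>
  define lab where "lab i = take D (suffix_from (T (\<lambda>_. {})) (suffix_array (T (\<lambda>_. {})) i))" for i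
  have lab: "take D (suffix_from (T X) (suffix_array (T X) i)) = lab i" if "i \<in> {1..2 ^ D * ?b}" for X i
    unfolding lab_def using that
    by (intro suffix_array_window) (auto simp: T_def intro: windows_encoding[OF D] simp: length_encoding[OF D])
  have "\<exists>k<2 ^ D. word_list D ! k = u" if "u \<in> words D" for u
    using that word_list[of D] by (metis in_set_conv_nth)
  then obtain idx where idx: "idx u < 2 ^ D \<and> word_list D ! idx u = u" if "u \<in> words D" for u
    by metis
  \<comment> \<open>Ball \<open>v\<close> shows its state of time \<open>t\<close> at offset
    \<open>t\<close> of the block of its starting word; \<open>Suc\<close> accounts for positions
    counted from 1. Dividing by the block length recovers the starting word.\<close>
  define pos where "pos X t v = Suc (idx (state L X 0 v) * ?b + t)" for X t v
  define qidx where "qidx X t v = inv (suffix_array (T X)) (pos X t v)" for X t v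
  define origin where "origin a = word_list D ! ((a - 1) div ?b)" for a
  have perm: "suffix_array (T X) permutes {1..2 ^ D * ?b}" for X
    using suffix_array_is_suffix_array[of "T X"] by (simp add: is_suffix_array_def lenT)
  have SA: "suffix_array (T X) (qidx X t v) = pos X t v" for X t v
    unfolding qidx_def by (rule permutes_inverses(1)[OF perm])
  have qiI: "qidx X t v \<in> {1..2 ^ D * ?b}" if "t < L" "v \<in> words D" for X t v
  proof -
    have "Suc (idx (state L X 0 v)) * ?b \<le> 2 ^ D * ?b"
      using idx[OF state_in_words[OF D that(2)]] by (intro mult_le_mono1) (simp add: Suc_leI)
    then have "pos X t v \<in> {1..2 ^ D * ?b}" using that(1) by (simp add: pos_def)
    then show ?thesis using permutes_in_image[OF perm[of X], of "qidx X t v"] unfolding SA by simp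
  qed
  have rules: "memory_of_width w (prep (T X))" "real (space_bits w (prep (T X))) \<le> S"
    "y \<in> {1..2 ^ D * ?b} \<Longrightarrow> set (probed (prep (T X)) (query y)) \<subseteq> {..<length (prep (T X))} \<and>
       length (probed (prep (T X)) (query y)) \<le> Q \<and> outcome (prep (T X)) (query y) = suffix_array (T X) y" for X y
    using ds T[of X] by (auto simp: suffix_array_ds_def cell_probe_ds_def lenT)
  have "scheme D L w M Q {1..2 ^ D * ?b} query lab (\<lambda>X. prep (T X)) qidx origin B"
  proof
    fix X t v
    show "length (prep (T X)) \<le> M"
    proof (rule ccontr)
      assume "\<not> ?thesis"
      then have "real M + 1 \<le> real (length (prep (T X)))" by linarith
      then have "real w * (real M + 1) \<le> real w * real (length (prep (T X)))" by (rule mult_left_mono) simp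
      then show False using rules(2)[of X] M by (simp add: space_bits_def)
    qed
    assume t: "t < L" and v: "v \<in> words D"
    note i = qiI[OF t v, of X]
    show "qidx X t v \<in> {1..2 ^ D * ?b}" by (rule i)
    have k: "idx (state L X 0 v) < 2 ^ D" "word_list D ! idx (state L X 0 v) = state L X 0 v"
      using idx[OF state_in_words[OF D v]] by auto
    have "lab (qidx X t v) = take D (drop (idx (state L X 0 v) * ?b + t) (encoding D L X))"
      unfolding lab[OF i, of X, symmetric] SA by (simp add: pos_def suffix_from_def T_def)
    also have "\<dots> = take D (drop 0 (state L X t v) @ replicate D True)"
      using window_stream[OF D k(1), of t L X] t k(2) forward_state[OF D v, of t L X] by simp
    also have "\<dots> = state L X t v" using state_in_words[OF D v, of L X t] by (simp add: words_def)
    finally show "lab (qidx X t v) = state L X t v" .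
    show "set (probed (prep (T X)) (query (qidx X t v))) \<subseteq> {..<length (prep (T X))}"
      "length (probed (prep (T X)) (query (qidx X t v))) \<le> Q"
      using rules(3)[OF i, of X] by auto
    have "outcome (prep (T X)) (query (qidx X t v)) = pos X t v" using rules(3)[OF i, of X] SA by simp
    moreover have "(pos X t v - 1) div ?b = idx (state L X 0 v)"
    proof -
      have "(idx (state L X 0 v) * ?b + t) div ?b = idx (state L X 0 v)"
        using t by (intro div_nat_eqI) (auto simp: algebra_simps)
      then show ?thesis by (simp add: pos_def)
    qed
    ultimately show "origin (outcome (prep (T X)) (query (qidx X t v))) = state L X 0 v"
      using k(2) by (simp add: origin_def)
  qed (use D LD B rules(1) in auto)
  then show ?thesis unfolding T_def by blast
qed

section \<open>Choice of parameters\<close>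

text \<open>Without probes the answer ignores the text, but the two orders of two distinct bits have
  different first suffixes. Later parameters divide by \<open>Q\<close>.\<close>

lemma probes_pos:
  assumes "suffix_array_ds N w S Q prep query" "N \<ge> 2"
  shows "Q > 0"
proof (rule ccontr)
  assume "\<not> Q > 0"
  let ?A = "[False, True]" and ?B = "[True, False]"
  have ans: "outcome (prep T) (query 1) = suffix_array T 1 \<and> probed (prep T) (query 1) = []"
    if "length T = 2" for T
    using assms that \<open>\<not> Q > 0\<close> by (auto simp: suffix_array_ds_def cell_probe_ds_def)
  obtain a where a: "query 1 = Answer a" using ans[of ?A] by (cases "query 1") auto
  have eq: "suffix_array ?A 1 = suffix_array ?B 1" using ans[of ?A] ans[of ?B] a by simp
  have p: "suffix_array T permutes {1..2}" "ord_class.lexordp (suffix_from T (suffix_array T 1)) (suffix_from T (suffix_array T 2))"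
    if "length T = 2" for T :: "bool list"
    using suffix_array_is_suffix_array[of T] that by (auto simp: is_suffix_array_def numeral_2_eq_2)
  have val: "suffix_array T 1 = 1 \<and> suffix_array T 2 = 2 \<or> suffix_array T 1 = 2 \<and> suffix_array T 2 = 1"
    if "length T = 2" for T :: "bool list"
  proof -
    have "suffix_array T 1 \<in> {1..2}" "suffix_array T 2 \<in> {1..2}"
      using permutes_in_image[OF p(1)[OF that]] by auto
    moreover have "suffix_array T 1 \<noteq> suffix_array T 2"
      using permutes_inj[OF p(1)[OF that]] by (simp add: inj_eq)
    ultimately show ?thesis by force
  qed
  have "suffix_array ?A 1 = 1" using val[of ?A] p(2)[of ?A] by (auto simp: suffix_from_def)
  moreover have "suffix_array ?B 1 = 2" using val[of ?B] p(2)[of ?B] by (auto simp: suffix_from_def)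
  ultimately show False using eq by simp
qed

lemma too_few_probes:
  fixes a1 a2 a3 :: real and N w Q :: nat and S :: real
  defines "\<kappa> \<equiv> log 2 (real N)" and "\<Lambda> \<equiv> log 2 (log 2 (real N))"
    and "p \<equiv> S / real N * log 2 (log 2 (real N))" and "C \<equiv> 2304 * (a2 + 2)"
  assumes a: "a1 > 0" "a2 > 0" "a3 > 0" and N: "N \<ge> 2"
    and w: "a1 * \<kappa> \<le> real w" "real w \<le> a2 * \<kappa>" and S: "a3 * real N \<le> S"
    and ds: "suffix_array_ds N w S Q prep query"
    and few: "Q * log 2 p < \<Lambda> / 32"
    and \<kappa>: "\<kappa> \<ge> 325" "\<Lambda> \<ge> 1" "2 * \<Lambda> + 6 \<le> \<kappa>" "8 * \<kappa> powr (1 / 4) \<le> \<kappa>" "2 * C * \<Lambda> \<le> \<kappa>"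
      "1 / a1 + 1 \<le> \<kappa>" "1536 * \<Lambda> \<le> \<kappa>" "13824 * \<Lambda>\<^sup>2 * \<kappa> powr (1 / 4) \<le> \<kappa>"
      "sqrt \<Lambda> \<le> a3 * \<Lambda>" "192 * C / a1 + 2 \<le> a3 * \<Lambda>"
  shows False
proof -
  \<comment> \<open>The text has at most 3 D 2^D bits; taking 2^D at most N / (4 log N) makes it
    fit.\<close>
  define D where "D = nat \<lfloor>\<kappa> - \<Lambda> - 2\<rfloor>"
  define x where x: "x = (2::real) ^ D"
  define \<sigma> where "\<sigma> = S / real N"
  have C: "C > 0" using a by (simp add: C_def)
  have N0: "real N > 0" and \<kappa>0: "\<kappa> > 0" and \<Lambda>0: "\<Lambda> > 0" using N \<kappa> by auto
  have N_eq: "real N = 2 powr \<kappa>" using N0 by (simp add: \<kappa>_def)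
  have \<Lambda>_eq: "\<kappa> = 2 powr \<Lambda>" using \<kappa>0 by (simp add: \<Lambda>_def \<kappa>_def)
  have \<sigma>: "\<sigma> \<ge> a3" using S N0 by (simp add: \<sigma>_def le_divide_eq)
  then have \<sigma>0: "\<sigma> > 0" using a by linarith
  have p: "p = \<sigma> * \<Lambda>" by (simp add: p_def \<sigma>_def \<Lambda>_def)
  have pa: "a3 * \<Lambda> \<le> p" using \<sigma> \<Lambda>0 by (simp add: p)
  have C3: "192 * C / a1 \<ge> 0" using C a by simp
  have p2: "p \<ge> 2" and pC: "p \<ge> 192 * C / a1 + 1" using pa \<kappa>(10) C3 by linarith+
  have p\<Lambda>: "\<Lambda> \<le> p\<^sup>2"
  proof -
    have "sqrt \<Lambda> \<le> p" using \<kappa>(9) pa by linarith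
    then have "(sqrt \<Lambda>)\<^sup>2 \<le> p\<^sup>2" using \<Lambda>0 by (intro power_mono) auto
    then show ?thesis using \<Lambda>0 by simp
  qed
  have \<sigma>p: "\<sigma> \<le> p" using \<kappa>(2) \<sigma>0 by (simp add: p)
  have Q: "Q > 0" by (rule probes_pos[OF ds N])
  then have Q1: "real Q \<ge> 1" by linarith
  have lp: "log 2 p \<ge> 1" using p2 by (simp add: le_log_iff)
  have lpQ: "log 2 p \<le> Q * log 2 p" and QlpQ: "real Q \<le> Q * log 2 p" using Q1 lp by auto
  have Q\<Lambda>: "real Q \<le> \<Lambda>" using few QlpQ \<Lambda>0 by linarith
  have p\<kappa>: "p \<le> \<kappa>"
  proof -
    have "log 2 p \<le> \<Lambda>" using few lpQ \<Lambda>0 by linarith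
    then have "2 powr log 2 p \<le> 2 powr \<Lambda>" by simp
    then show ?thesis using p2 by (simp add: \<Lambda>_eq[symmetric])
  qed
  have \<sigma>\<kappa>: "\<sigma> \<le> \<kappa>" using \<sigma>p p\<kappa> by linarith
  have Dr: "real D \<le> \<kappa> - \<Lambda> - 2" "\<kappa> - \<Lambda> - 3 \<le> real D" using \<kappa> unfolding D_def by linarith+
  have D\<kappa>: "\<kappa> / 2 \<le> real D" "real D \<le> \<kappa>" using Dr \<kappa> by linarith+
  have D0: "D > 0" using D\<kappa> \<kappa>0 by (cases D) auto
  have xp: "x = 2 powr real D" by (simp add: x powr_realpow)
  have x_le: "4 * \<kappa> * x \<le> real N"
  proof -
    have "x \<le> 2 powr (\<kappa> - \<Lambda> - 2)" unfolding xp using Dr by simp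
    also have "\<dots> = real N / \<kappa> / 4" by (simp add: powr_diff N_eq \<Lambda>_eq[symmetric])
    finally show ?thesis using \<kappa>0 by (simp add: field_simps)
  qed
  have x_ge: "real N \<le> 8 * \<kappa> * x"
  proof -
    have "real N / \<kappa> / 8 = 2 powr (\<kappa> - \<Lambda> - 3)" by (simp add: powr_diff N_eq \<Lambda>_eq[symmetric])
    also have "\<dots> \<le> x" unfolding xp using Dr by simp
    finally show ?thesis using \<kappa>0 by (simp add: field_simps)
  qed
  have xD: "real D \<le> x" unfolding x using of_nat_less_two_power[of D, where 'a = real] by linarith
  have x0: "x > 0" by (simp add: x)
  \<comment> \<open>The popular cells require \<open>m_ge\<close>. Since \<open>\<sigma>\<close> is
    at most \<open>p\<close> and \<open>Q\<close> at most \<open>p ^ 2\<close>, the product in it is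
    at most \<open>p ^ 7\<close> up to a constant, which the eighth factor absorbs.\<close>
  define m where "m = nat \<lfloor>p ^ 8\<rfloor>"
  have "p ^ 8 \<ge> 0" using p2 by simp
  then have mr: "real m \<le> p ^ 8" "p ^ 8 - 1 \<le> real m" unfolding m_def by linarith+
  have m_ge: "192 * C / a1 * (\<sigma> * Q ^ 3) \<le> real m"
  proof -
    have "real Q \<le> p\<^sup>2" using Q\<Lambda> p\<Lambda> by linarith
    then have "real Q ^ 3 \<le> (p\<^sup>2) ^ 3" by (intro power_mono) auto
    then have "\<sigma> * real Q ^ 3 \<le> p * (p\<^sup>2) ^ 3" using \<sigma>p \<sigma>0 p2 by (intro mult_mono) auto
    also have "\<dots> = p ^ 7" by (simp add: eval_nat_numeral)
    finally have "192 * C / a1 * (\<sigma> * Q ^ 3) \<le> 192 * C / a1 * p ^ 7" using C3 by (intro mult_left_mono) auto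
    also have "\<dots> \<le> (p - 1) * p ^ 7" using pC p2 by (intro mult_right_mono) auto
    also have "\<dots> = p ^ 8 - p ^ 7" by (simp add: eval_nat_numeral algebra_simps)
    also have "\<dots> \<le> p ^ 8 - 1" using one_le_power[of p 7] p2 by simp
    finally show ?thesis using mr by linarith
  qed
  have m0: "m > 0"
  proof -
    have "p ^ 1 \<le> p ^ 8" using p2 by (intro power_increasing) auto
    then have "real m > 0" using mr p2 by simp
    then show ?thesis by simp
  qed
  \<comment> \<open>The constant 32 arises here as the exponent 8 of \<open>m\<close> times 4 for
    the fourth root.\<close>
  have mQ: "real m ^ Q \<le> \<kappa> powr (1 / 4)"
  proof -
    have "real m ^ Q \<le> (p ^ 8) ^ Q" using mr by (intro power_mono) auto
    also have "\<dots> = p powr real (8 * Q)" using p2 powr_realpow[of p "8 * Q"] by (simp only: power_mult)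
    also have "\<dots> = (2 powr log 2 p) powr real (8 * Q)" using p2 by simp
    also have "\<dots> = 2 powr (8 * (Q * log 2 p))" by (simp add: powr_powr mult_ac)
    also have "\<dots> \<le> 2 powr (\<Lambda> / 4)" using few by simp
    also have "\<dots> = (2 powr \<Lambda>) powr (1 / 4)" by (simp add: powr_powr)
    finally show ?thesis by (simp add: \<Lambda>_eq[symmetric])
  qed
  \<comment> \<open>\<open>L\<close> rounds \<open>D\<close> down to a multiple of
    \<open>2 * m ^ Q\<close>, which loses at most half of \<open>D\<close>.\<close>
  define g where "g = D div (2 * m ^ Q)"
  define L where "L = 2 * m ^ Q * g"
  have LD: "L \<le> D" by (simp add: L_def g_def)
  have LD2: "real D / 2 \<le> real L"
  proof -
    have "D = L + D mod (2 * m ^ Q)" unfolding L_def g_def by simp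
    moreover have "D mod (2 * m ^ Q) < 2 * m ^ Q" using m0 by simp
    ultimately have "D \<le> L + 2 * m ^ Q" by linarith
    then have "real D \<le> real (L + 2 * m ^ Q)" by (simp only: of_nat_le_iff)
    then have "real D \<le> real L + 2 * real m ^ Q" by simp
    then show ?thesis using mQ \<kappa>(4) D\<kappa> by linarith
  qed
  have g0: "g > 0" using LD2 D0 by (cases g) (auto simp: L_def)
  \<comment> \<open>With at most \<open>3 * D * x\<close> text positions this makes
    \<open>n / B\<close> at most x / (6 Q D), the bound needed for crowded times as
    \<open>L \<le> D\<close>.\<close>
  define B where "B = 18 * Q * D\<^sup>2"
  have B0: "B > 0" using Q D0 by (simp add: B_def)
  define M where "M = nat \<lfloor>S / w\<rfloor>"
  have w0: "real w > 0" using w(1) a(1) \<kappa>0 by (meson less_le_trans mult_pos_pos)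
  have S0: "S > 0" using S a N0 by (meson less_le_trans mult_pos_pos)
  have "S / w \<ge> 0" using S0 by simp
  then have Mr: "real M \<le> S / w" "S / w < real M + 1" unfolding M_def by linarith+
  have M_le: "real M \<le> \<sigma> * real N / (a1 * \<kappa>)"
  proof -
    have "real M \<le> S / (a1 * \<kappa>)" 
      using Mr(1) w(1) S0 a(1) \<kappa>0 w0 divide_left_mono[of "a1 * \<kappa>" "real w" S] by (auto intro: order_trans)
    then show ?thesis using N0 by (simp add: \<sigma>_def)
  qed
  \<comment> \<open>The allowance of popular cells per round. All rounds use x / (C Q) of them and
    at most as many heavy cells, whence the 2 in \<open>s\<close>.\<close>
  define q where "q = x / (C * Q ^ 2)"
  have q0: "q > 0" using x0 C Q1 by (simp add: q_def)
  define s where "s = nat \<lceil>2 * x / (C * Q)\<rceil>"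
  have "2 * x / (C * Q) \<ge> 0" using x0 C by simp
  then have sr: "2 * x / (C * Q) \<le> real s" "real s \<le> 2 * x / (C * Q) + 1" unfolding s_def by linarith+
  have "C * Q \<le> C * \<Lambda>" using Q\<Lambda> C by simp
  then have CQ: "C * Q \<le> real D" using \<kappa>(5) D\<kappa> by linarith
  have CQ0: "C * Q > 0" using C Q1 by simp
  have sx: "real s \<le> 3 * x / (C * Q)"
  proof -
    have "1 \<le> x / (C * Q)" using CQ CQ0 xD by (simp add: le_divide_eq)
    then show ?thesis using sr(2) by simp
  qed
  define n where "n = 2 ^ D * (L + 2 * D)"
  have nx: "real n \<le> x * (3 * D)" unfolding n_def x using LD by simp
  have "n \<le> N"
  proof -
    have "x * real (3 * D) \<le> x * (3 * \<kappa>)" using D\<kappa> x0 by (intro mult_left_mono) auto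
    then have "real n \<le> x * (3 * \<kappa>)" using nx by linarith
    also have "\<dots> \<le> 4 * \<kappa> * x" using \<kappa>0 x0 by simp
    finally show ?thesis using x_le by simp
  qed
  then have "\<exists>lab qidx origin. scheme D L w M Q {1..n} query lab (\<lambda>X. prep (encoding D L X)) qidx origin B"
    using scheme_of_suffix_array_ds[OF ds D0 LD, of M B] Mr(2) w0 B0
    by (simp add: n_def divide_less_eq mult.commute)
  then obtain lab qidx origin where "scheme D L w M Q {1..n} query lab (\<lambda>X. prep (encoding D L X)) qidx origin B" by blast
  then interpret scheme D L w M Q "{1..n}" query lab "\<lambda>X. prep (encoding D L X)" qidx origin B .
  have nB: "real n / B \<le> x / (6 * Q * D)"
  proof -
    have "real n / B \<le> x * (3 * D) / B" using nx by (rule divide_right_mono) simp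
    also have "\<dots> = x / (6 * Q * D)" using Q D0 by (simp add: B_def power2_eq_square)
    finally show ?thesis .
  qed
  show False
  proof (rule impossible[OF Q m0 g0 q0 L_def, of s])
    have "real L * (real n / B) \<le> real D * (x / (6 * Q * D))" using LD nB by (intro mult_mono) auto
    also have "\<dots> = x / (6 * Q)" using D0 by simp
    finally show "real (L * card {1..n}) / real B \<le> 2 ^ D / real (6 * Q)" by (simp add: x)
    show "real (24 * Q * M) \<le> q * real m"
    proof -
      have "real (24 * Q * M) \<le> 24 * Q * (\<sigma> * (8 * \<kappa> * x) / (a1 * \<kappa>))"
      proof -
        have "\<sigma> * real N / (a1 * \<kappa>) \<le> \<sigma> * (8 * \<kappa> * x) / (a1 * \<kappa>)"
          using x_ge \<sigma>0 a \<kappa>0 by (intro divide_right_mono mult_left_mono) auto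
        then have "real M \<le> \<sigma> * (8 * \<kappa> * x) / (a1 * \<kappa>)" using M_le by linarith
        then have "real (24 * Q) * real M \<le> 24 * Q * (\<sigma> * (8 * \<kappa> * x) / (a1 * \<kappa>))" by (intro mult_left_mono) auto
        then show ?thesis by simp
      qed
      also have "\<dots> = q * (192 * C / a1 * (\<sigma> * Q ^ 3))"
        using \<kappa>0 a C Q by (simp add: q_def field_simps power2_eq_square power3_eq_cube)
      also have "\<dots> \<le> q * real m" using m_ge q0 by (intro mult_left_mono) auto
      finally show ?thesis .
    qed
    show "real Q * (q + real (card {1..n}) / real B) \<le> real s"
    proof -
      have "real Q * q = x / (C * Q)" using Q by (simp add: q_def power2_eq_square)
      moreover have "real Q * (real n / B) \<le> x / (C * Q)"
      proof -
        have "real Q * (real n / B) \<le> real Q * (x / (6 * Q * D))" using nB by (intro mult_left_mono) auto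
        also have "\<dots> = x / (6 * D)" using Q by simp
        also have "\<dots> \<le> x / (C * Q)" using CQ CQ0 x0 by (intro divide_left_mono) auto
        finally show ?thesis .
      qed
      ultimately have "real Q * (q + real n / B) \<le> 2 * x / (C * Q)" by (simp add: distrib_left)
      then show ?thesis using sr(1) by simp
    qed
    show "(1 + real M * 2 ^ w) ^ s * real (2 * Q + 1) * (1 + (real L * real B)\<^sup>2) ^ (2 * m ^ Q * 2 ^ D)
       < 2 powr (real (L * 2 ^ D) / real (48 * Q))"
    proof -
      \<comment> \<open>As \<open>L\<close> is at least \<open>\<kappa> / 4\<close>, the saving is
        at least \<open>4 * y\<close>. Published cells, number of events and certificates cost at
        most \<open>y\<close> bits each.\<close>
      define y where "y = \<kappa> * x / (768 * Q)"
      have y0: "y > 0" using \<kappa>0 x0 Q1 by (simp add: y_def)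
      have e1: "(1 + real M * 2 ^ w) ^ s \<le> 2 powr y"
      proof -
        have "real M \<le> real N / a1"
        proof -
          have "\<sigma> * real N / (a1 * \<kappa>) \<le> \<kappa> * real N / (a1 * \<kappa>)"
            using \<sigma>\<kappa> a \<kappa>0 by (intro divide_right_mono mult_right_mono) auto
          then show ?thesis using M_le \<kappa>0 by simp
        qed
        moreover have "1 \<le> real N" using N by simp
        ultimately have "1 + real M \<le> real N * (1 / a1 + 1)" by (simp add: algebra_simps)
        also have "\<dots> \<le> real N * \<kappa>" using \<kappa>(6) by (intro mult_left_mono) auto
        finally have "1 + real M \<le> real N * \<kappa>" .
        moreover have "\<kappa> \<le> real N"
        proof -
          have "1 \<le> x" using xD D\<kappa> \<kappa>(1) by linarith
          then have "\<kappa> * 1 \<le> \<kappa> * x" using \<kappa>0 by (intro mult_left_mono) auto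
          moreover have "0 \<le> \<kappa> * x" using \<kappa>0 x0 by simp
          ultimately show ?thesis using x_le by linarith
        qed
        then have "real N * \<kappa> \<le> real N * real N" by (rule mult_left_mono) simp
        ultimately have M1: "1 + real M \<le> real N * real N" by linarith
        have "1 + real M * 2 ^ w \<le> (1 + real M) * 2 ^ w" by (simp add: distrib_right)
        also have "\<dots> \<le> (real N * real N) * 2 powr (a2 * \<kappa>)"
          using M1 w(2) by (intro mult_mono) (auto simp flip: powr_realpow)
        also have "\<dots> = 2 powr ((a2 + 2) * \<kappa>)" by (simp add: N_eq algebra_simps flip: powr_add)
        finally have "(1 + real M * 2 ^ w) ^ s \<le> (2 powr ((a2 + 2) * \<kappa>)) ^ s" by (intro power_mono) auto
        also have "\<dots> = 2 powr ((a2 + 2) * \<kappa> * s)" by (simp add: powr_powr flip: powr_realpow)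
        also have "\<dots> \<le> 2 powr y"
        proof -
          have "(a2 + 2) * \<kappa> * s \<le> (a2 + 2) * \<kappa> * (3 * x / (C * Q))" using sx a \<kappa>0 by (intro mult_left_mono) auto
          \<comment> \<open>This determines \<open>C\<close>: 2304 is 3 times 768, the 3 coming from
            \<open>sx\<close>.\<close>
          also have "\<dots> = y"
          proof -
            have "b * \<kappa> * (3 * x / (2304 * b * Q)) = \<kappa> * x / (768 * Q)" if "b > 0" for b :: real
              using that Q by (simp add: field_simps)
            from this[of "a2 + 2"] show ?thesis using a unfolding C_def y_def by argo
          qed
          finally show ?thesis by simp
        qed
        finally show ?thesis .
      qed
      have e2: "real (2 * Q + 1) \<le> 2 powr y"
      proof -
        have "2 * Q + 1 \<le> 2 ^ (2 * Q)" using Q by (induction Q rule: nat_induct_non_zero) auto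
        then have "real (2 * Q + 1) \<le> 2 ^ (2 * Q)" by (rule real_le_two_power)
        also have "\<dots> = 2 powr real (2 * Q)" by (rule powr_realpow[symmetric]) simp
        also have "\<dots> \<le> 2 powr y"
        proof -
          have "1536 * real Q \<le> \<kappa>" using Q\<Lambda> \<kappa>(7) by linarith
          moreover have "real Q \<le> x" using Q\<Lambda> xD D\<kappa> \<kappa>(3) by linarith
          ultimately have "1536 * real Q * real Q \<le> \<kappa> * x" using \<kappa>0 by (intro mult_mono) auto
          then have "real (2 * Q) \<le> y" using Q by (simp add: y_def le_divide_eq)
          then show ?thesis by simp
        qed
        finally show ?thesis .
      qed
      have e3: "(1 + (real L * real B)\<^sup>2) ^ (2 * m ^ Q * 2 ^ D) \<le> 2 powr y"
      proof -
        have Q\<kappa>: "real Q \<le> \<kappa>" using Q\<Lambda> \<kappa>(3) \<Lambda>0 by linarith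
        have "real L * real B \<le> \<kappa> * (18 * \<kappa> * \<kappa>\<^sup>2)"
          unfolding B_def using LD D\<kappa> Q\<kappa> \<kappa>0 by (auto intro!: mult_mono power_mono)
        then have "(real L * real B)\<^sup>2 \<le> (\<kappa> * (18 * \<kappa> * \<kappa>\<^sup>2))\<^sup>2" by (intro power_mono) auto
        also have "\<dots> = 324 * \<kappa> ^ 8" by (simp add: eval_nat_numeral)
        finally have "1 + (real L * real B)\<^sup>2 \<le> 1 + 324 * \<kappa> ^ 8" by simp
        \<comment> \<open>324 is the square of the 18 in \<open>B\<close>; the resulting 325 is
          absorbed by one more factor \<open>\<kappa>\<close>.\<close>
        also have "\<dots> \<le> 325 * \<kappa> ^ 8" using one_le_power[of \<kappa> 8] \<kappa>(1) by simp
        also have "\<dots> \<le> \<kappa> * \<kappa> ^ 8" using \<kappa>(1) by (intro mult_right_mono) auto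
        also have "\<dots> = 2 powr (9 * \<Lambda>)"
        proof -
          have "2 powr (9 * \<Lambda>) = (2 powr \<Lambda>) powr 9" by (simp add: powr_powr mult.commute)
          also have "\<dots> = \<kappa> ^ 9" using \<kappa>0 by (simp add: \<Lambda>_eq[symmetric])
          finally show ?thesis by (simp add: eval_nat_numeral)
        qed
        finally have "(1 + (real L * real B)\<^sup>2) ^ (2 * m ^ Q * 2 ^ D) \<le> (2 powr (9 * \<Lambda>)) ^ (2 * m ^ Q * 2 ^ D)"
          by (intro power_mono) auto
        also have "\<dots> = 2 powr (9 * \<Lambda> * real (2 * m ^ Q * 2 ^ D))" by (simp add: powr_powr flip: powr_realpow)
        also have "\<dots> \<le> 2 powr y"
        proof -
          have "9 * \<Lambda> * real (2 * m ^ Q * 2 ^ D) = 18 * \<Lambda> * x * real m ^ Q" by (simp add: x)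
          also have "\<dots> \<le> 18 * \<Lambda> * x * \<kappa> powr (1 / 4)" using mQ \<Lambda>0 x0 by (intro mult_left_mono) auto
          also have "\<dots> \<le> y"
          proof -
            have "18 * \<Lambda> * x * \<kappa> powr (1 / 4) * (768 * Q) \<le> 18 * \<Lambda> * x * \<kappa> powr (1 / 4) * (768 * \<Lambda>)"
              using Q\<Lambda> \<Lambda>0 x0 by (intro mult_left_mono) auto
            also have "\<dots> = 13824 * \<Lambda>\<^sup>2 * \<kappa> powr (1 / 4) * x" by (simp add: power2_eq_square)
            also have "\<dots> \<le> \<kappa> * x" using \<kappa>(8) x0 by (intro mult_right_mono) auto
            finally show ?thesis using Q by (simp add: y_def le_divide_eq)
          qed
          finally show ?thesis by simp
        qed
        finally show ?thesis .
      qed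
      have "(1 + real M * 2 ^ w) ^ s * real (2 * Q + 1) * (1 + (real L * real B)\<^sup>2) ^ (2 * m ^ Q * 2 ^ D)
          \<le> 2 powr y * 2 powr y * 2 powr y"
        using e1 e2 e3 by (intro mult_mono) auto
      also have "\<dots> = 2 powr (3 * y)" by (simp flip: powr_add)
      also have "\<dots> < 2 powr (real (L * 2 ^ D) / real (48 * Q))"
      proof -
        have "3 * y < 4 * y" using y0 by simp
        also have "4 * y = \<kappa> / 4 * x / (48 * Q)" using Q by (simp add: y_def)
        also have "\<dots> \<le> real L * x / (48 * Q)"
          using LD2 D\<kappa> x0 by (intro divide_right_mono mult_right_mono) auto
        also have "\<dots> = real (L * 2 ^ D) / real (48 * Q)" by (simp add: x)
        finally show ?thesis by simp
      qed
      finally show ?thesis .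
    qed
  qed
qed

theorem theorem1p1:
  fixes a1 a2 a3 :: real
  assumes "a1 > 0" and "a2 > 0" and "a3 > 0"
  shows "\<exists>c::real. c > 0 \<and> (\<exists>N0::nat. \<forall>N\<ge>N0. \<forall>(w::nat) (S::real) (Q::nat) prep query.
           a1 * log 2 (real N) \<le> real w \<longrightarrow>
           real w \<le> a2 * log 2 (real N) \<longrightarrow>
           a3 * real N \<le> S \<longrightarrow>
           suffix_array_ds N w S Q prep query \<longrightarrow>
           real Q \<ge> c * (log 2 (log 2 (real N)) / log 2 ((S / real N) * log 2 (log 2 (real N)))))"
proof -
  define C where "C = 2304 * (a2 + 2)"
  \<comment> \<open>All requirements on the size of N, as conditions on its logarithm that hold
    eventually.\<close>
  define ok where "ok l \<longleftrightarrow> l \<ge> 325 \<and> log 2 l \<ge> 1 \<and> 2 * log 2 l + 6 \<le> l \<and> 8 * l powr (1 / 4) \<le> l \<and>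
    2 * C * log 2 l \<le> l \<and> 1 / a1 + 1 \<le> l \<and> 1536 * log 2 l \<le> l \<and>
    13824 * (log 2 l)\<^sup>2 * l powr (1 / 4) \<le> l \<and> sqrt (log 2 l) \<le> a3 * log 2 l \<and>
    192 * C / a1 + 2 \<le> a3 * log 2 l" for l :: real
  have "C > 0" using assms by (simp add: C_def)
  have "eventually ok at_top"
    unfolding ok_def using assms \<open>C > 0\<close> by (intro eventually_conj; real_asymp)
  moreover have "filterlim (\<lambda>N. log 2 (real N)) at_top at_top" by real_asymp
  ultimately have "eventually (\<lambda>N. ok (log 2 (real N))) at_top"
    by (rule eventually_compose_filterlim)
  then have "eventually (\<lambda>N. ok (log 2 (real N)) \<and> N \<ge> 2) at_top"
    using eventually_ge_at_top[of 2] by (rule eventually_conj)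
  then obtain N0 where N0: "\<And>N. N \<ge> N0 \<Longrightarrow> ok (log 2 (real N)) \<and> N \<ge> 2"
    by (auto simp: eventually_at_top_linorder)
  show ?thesis
  proof (intro exI[of _ "1 / 32"] conjI exI[of _ N0] allI impI)
    fix N w :: nat and S :: real and Q prep query
    let ?\<Lambda> = "log 2 (log 2 (real N))" and ?p = "S / real N * log 2 (log 2 (real N))"
    assume N: "N \<ge> N0" and w: "a1 * log 2 (real N) \<le> real w" "real w \<le> a2 * log 2 (real N)"
      and S: "a3 * real N \<le> S" and ds: "suffix_array_ds N w S Q prep query"
    have ok: "ok (log 2 (real N))" and N2: "N \<ge> 2" using N0[OF N] by auto
    have "\<not> Q * log 2 ?p < ?\<Lambda> / 32"
      using too_few_probes[OF assms N2 w S ds] ok unfolding ok_def C_def by blast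
    \<comment> \<open>The denominator of the claimed bound is positive, so it can be multiplied
      out.\<close>
    moreover have "log 2 ?p > 0"
    proof -
      have "a3 \<le> S / real N" using S N2 by (simp add: le_divide_eq)
      then have "a3 * ?\<Lambda> \<le> ?p" using ok by (intro mult_right_mono) (auto simp: ok_def)
      moreover have "2 \<le> a3 * ?\<Lambda>"
      proof -
        have "192 * C / a1 \<ge> 0" using assms \<open>C > 0\<close> by simp
        then show ?thesis using ok unfolding ok_def by linarith
      qed
      ultimately show ?thesis by simp
    qed
    ultimately show "1 / 32 * (?\<Lambda> / log 2 ?p) \<le> real Q"
      by (simp add: field_simps)
  qed simp
qed

end
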